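(* Let $\mathbb F$ be a perfect field of characteristic $2$. Let $W$ and $W'$ be $\mathbb F$-vector spaces of dimensions $n\ge1$ and $n'\ge1$ with nondegenerate symmetric bilinear forms $b$ and $b'$, where $n$ and $n'$ have the same parity, and let $V=W\perp W'$ be their orthogonal direct sum. Let $S$ be a maximal totally isotropic subspace of $V$, with $U=S\cap W$ of dimension $k$ and $U'=S\cap W'$ of dimension $k'$. Then (a) $n-n'=2(k-k')$, (b) $U$ and $U'$ have compatible isotropy types, and, if $\mathcal K$ is a vector space complement for $U$ in $U^\perp$ and $\mathcal K'$ is a vector space complement for $U'$ in $(U')^\perp$, then $S=U\perp\widetilde S\perp U'$, where $\widetilde S$ is a diagonal subspace of $\mathcal K\perp\mathcal K'$: $$\widetilde S=\{w+\tau w\mid w\in\mathcal K\}$$ for a unique isometry $\tau:\mathcal K\to\mathcal K'$. Conversely, if $U$ is a totally isotropic subspace of $W$ of dimension $k$ and $U'$ is a totally isotropic subspace of $W'$ of dimension $k'$ satisfying (a) and (b), then there exist precisely $\#\operatorname{Aut}(\mathcal K)$ maximal totally isotropic subspaces $S$ of $V$ with $S\cap W=U$ and $S\cap W'=U'$, where $\mathcal K$ is any vector space complement for $U$ in $U^\perp$.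
   Context: The form on $V=W\perp W'$ is $B(w_1+w_1',w_2+w_2')=b(w_1,w_2)+b'(w_1',w_2')$; $W$ and $W'$ are identified with subspaces of $V$. A subspace is totally isotropic if the form vanishes identically on it. For $U\subseteq W$, $U^\perp$ denotes the orthogonal subspace in $W$; for $U'\subseteq W'$, $(U')^\perp$ denotes the orthogonal subspace in $W'$. For a space $X$ with symmetric form, $\operatorname{rad}(X)$ is its radical, $\operatorname{Aut}(X)$ is its group of isometries. For a nondegenerate symmetric space $W$ over $\mathbb F$, the alternating subspace is $W_{\mathrm{alt}}=\{w\in W: b(w,w)=0\}$ (a subspace of codimension at most $1$). Totally isotropic subspaces $U\subseteq W$ and $U'\subseteq W'$ have compatible isotropy types if: $\operatorname{rad}(W_{\mathrm{alt}})\subseteq U$ if and only if $\operatorname{rad}(W'_{\mathrm{alt}})\subseteq U'$. *)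

theory Defs
  imports "HOL-Analysis.Product_Vector" "HOL-Library.FuncSet" "HOL-Library.Equipollence"
begin

text \<open>
  A vector space is given, as in \<^theory>\<open>HOL.Vector_Spaces\<close>, by a whole type together with its scalar
  multiplication \<open>s\<close>; its subspaces are sets. A form on the space is a function \<open>b\<close>, and the form of
  a subspace is the restriction of \<open>b\<close>.
\<close>

definition perfect_field :: "'f::field itself \<Rightarrow> bool"
  where "perfect_field _ \<longleftrightarrow> CHAR('f) = 0 \<or> surj (\<lambda>x::'f. x ^ CHAR('f))"

definition symmetric_bilinear_form ::
    "('f::field \<Rightarrow> 'v::ab_group_add \<Rightarrow> 'v) \<Rightarrow> ('v \<Rightarrow> 'v \<Rightarrow> 'f) \<Rightarrow> bool"
  where "symmetric_bilinear_form s b \<longleftrightarrow>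
    (\<forall>x. Vector_Spaces.linear s (*) (b x)) \<and>
    (\<forall>y. Vector_Spaces.linear s (*) (\<lambda>x. b x y)) \<and>
    (\<forall>x y. b x y = b y x)"

definition radical :: "('v \<Rightarrow> 'v \<Rightarrow> 'f::zero) \<Rightarrow> 'v set \<Rightarrow> 'v set"
  where "radical b X = {x \<in> X. \<forall>y\<in>X. b x y = 0}"

definition nondegenerate :: "('v::zero \<Rightarrow> 'v \<Rightarrow> 'f::zero) \<Rightarrow> bool"
  where "nondegenerate b \<longleftrightarrow> radical b UNIV = {0}"

definition orthogonal_space :: "('v \<Rightarrow> 'v \<Rightarrow> 'f::zero) \<Rightarrow> 'v set \<Rightarrow> 'v set"
  where "orthogonal_space b U = {w. \<forall>u\<in>U. b u w = 0}"

definition alternating_subspace :: "('v \<Rightarrow> 'v \<Rightarrow> 'f::zero) \<Rightarrow> 'v set"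
  where "alternating_subspace b = {w. b w w = 0}"

definition totally_isotropic ::
    "('f::field \<Rightarrow> 'v::ab_group_add \<Rightarrow> 'v) \<Rightarrow> ('v \<Rightarrow> 'v \<Rightarrow> 'f) \<Rightarrow> 'v set \<Rightarrow> bool"
  where "totally_isotropic s b U \<longleftrightarrow> module.subspace s U \<and> (\<forall>x\<in>U. \<forall>y\<in>U. b x y = 0)"

text \<open>Maximal means maximal with respect to inclusion.\<close>

definition maximal_totally_isotropic ::
    "('f::field \<Rightarrow> 'v::ab_group_add \<Rightarrow> 'v) \<Rightarrow> ('v \<Rightarrow> 'v \<Rightarrow> 'f) \<Rightarrow> 'v set \<Rightarrow> bool"
  where "maximal_totally_isotropic s b S \<longleftrightarrow>
    totally_isotropic s b S \<and> (\<forall>T. totally_isotropic s b T \<and> S \<subseteq> T \<longrightarrow> T = S)"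

definition compatible_isotropy_types ::
    "('v \<Rightarrow> 'v \<Rightarrow> 'f::zero) \<Rightarrow> ('w \<Rightarrow> 'w \<Rightarrow> 'f) \<Rightarrow> 'v set \<Rightarrow> 'w set \<Rightarrow> bool"
  where "compatible_isotropy_types b b' U U' \<longleftrightarrow>
    (radical b (alternating_subspace b) \<subseteq> U \<longleftrightarrow> radical b' (alternating_subspace b') \<subseteq> U')"

text \<open>
  The orthogonal direct sum of two spaces lives on the product type, with scalar multiplication
  \<^const>\<open>module_prod.scale\<close>; a subset \<open>X\<close> of the first summand is identified with \<open>X \<times> {0}\<close>,
  a subset \<open>Y\<close> of the second with \<open>{0} \<times> Y\<close>.
\<close>

definition sum_form ::
    "('v \<Rightarrow> 'v \<Rightarrow> 'f::plus) \<Rightarrow> ('w \<Rightarrow> 'w \<Rightarrow> 'f) \<Rightarrow> 'v \<times> 'w \<Rightarrow> 'v \<times> 'w \<Rightarrow> 'f"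
  where "sum_form b b' x y = b (fst x) (fst y) + b' (snd x) (snd y)"

definition is_complement ::
    "('f::field \<Rightarrow> 'v::ab_group_add \<Rightarrow> 'v) \<Rightarrow> 'v set \<Rightarrow> 'v set \<Rightarrow> 'v set \<Rightarrow> bool"
  where "is_complement s K U X \<longleftrightarrow>
    module.subspace s K \<and> U \<inter> K = {0} \<and> X = {u + w | u w. u \<in> U \<and> w \<in> K}"

text \<open>\<open>S = X \<perp> Y \<perp> Z\<close> as an internal orthogonal direct sum (of subspaces).\<close>

definition orthogonal_direct_sum ::
    "('v::ab_group_add \<Rightarrow> 'v \<Rightarrow> 'f::zero) \<Rightarrow> 'v set \<Rightarrow> 'v set \<Rightarrow> 'v set \<Rightarrow> 'v set \<Rightarrow> bool"
  where "orthogonal_direct_sum b S X Y Z \<longleftrightarrow>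
    S = {x + y + z | x y z. x \<in> X \<and> y \<in> Y \<and> z \<in> Z} \<and>
    (\<forall>x\<in>X. \<forall>y\<in>Y. \<forall>z\<in>Z. x + y + z = 0 \<longrightarrow> x = 0 \<and> y = 0 \<and> z = 0) \<and>
    (\<forall>x\<in>X. \<forall>y\<in>Y. b x y = 0) \<and> (\<forall>x\<in>X. \<forall>z\<in>Z. b x z = 0) \<and> (\<forall>y\<in>Y. \<forall>z\<in>Z. b y z = 0)"

text \<open>
  Maps defined on a subspace are made \<^const>\<open>extensional\<close> (undefined outside it), so that they
  can be counted and compared for equality as maps on the subspace.
\<close>

definition isometries ::
    "('f::field \<Rightarrow> 'v::ab_group_add \<Rightarrow> 'v) \<Rightarrow> ('v \<Rightarrow> 'v \<Rightarrow> 'f) \<Rightarrow> 'v set \<Rightarrow>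
     ('f \<Rightarrow> 'w::ab_group_add \<Rightarrow> 'w) \<Rightarrow> ('w \<Rightarrow> 'w \<Rightarrow> 'f) \<Rightarrow> 'w set \<Rightarrow> ('v \<Rightarrow> 'w) set"
  where "isometries s b X s' b' Y = {f \<in> extensional X. bij_betw f X Y \<and>
    (\<forall>x\<in>X. \<forall>y\<in>X. f (x + y) = f x + f y) \<and>
    (\<forall>c. \<forall>x\<in>X. f (s c x) = s' c (f x)) \<and>
    (\<forall>x\<in>X. \<forall>y\<in>X. b' (f x) (f y) = b x y)}"

definition isometry_group ::
    "('f::field \<Rightarrow> 'v::ab_group_add \<Rightarrow> 'v) \<Rightarrow> ('v \<Rightarrow> 'v \<Rightarrow> 'f) \<Rightarrow> 'v set \<Rightarrow> ('v \<Rightarrow> 'v) set"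
  where "isometry_group s b X = isometries s b X s b X"

definition diagonal_subspace :: "'v set \<Rightarrow> ('v \<Rightarrow> 'w) \<Rightarrow> ('v \<times> 'w) set"
  where "diagonal_subspace K \<tau> = {(w, \<tau> w) | w. w \<in> K}"

end

theory Submission
  imports Defs
begin

section \<open>Maximal totally isotropic subspaces of an orthogonal sum in characteristic 2\<close>

text \<open>
  Over a perfect field of characteristic 2, \<open>x \<mapsto> b x x\<close> is the square of a linear functional, so
  \<open>b x x = (b u x)\<^sup>2\<close> for a characteristic vector \<open>u\<close>. An orthonormal or symplectic basis gives
  \<open>b u u = n\<close> in the field; as \<open>n\<close> and \<open>n'\<close> have the same parity, \<open>(u, u')\<close> is an isotropic
  characteristic vector of the sum. It therefore lies in every maximal totally isotropic \<open>S\<close>,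
  and so \<open>S\<close> equals its own orthogonal space. Hence \<open>S\<close> projects onto the orthogonal spaces
  of \<open>U\<close> and \<open>U'\<close>, and \<open>S \<inter> (K \<times> K')\<close> is a totally isotropic subspace projecting onto
  the nondegenerate spaces \<open>K\<close> and \<open>K'\<close>, which makes it the graph of an isometry.
  Compatibility of the isotropy types says that \<open>u \<in> U\<close> iff \<open>u' \<in> U'\<close>, which in turn says that
  \<open>K\<close> is alternating iff \<open>K'\<close> is; together with equal dimension this makes \<open>K\<close> and \<open>K'\<close> isometric,
  and the subspaces \<open>S\<close> with the prescribed intersections correspond to the isometries \<open>K \<rightarrow> K'\<close>.
\<close>

subsection \<open>Symmetric bilinear forms\<close>

locale symmetric_form = vector_space s
  for s :: "'f::field \<Rightarrow> 'w::ab_group_add \<Rightarrow> 'w" +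
  fixes b :: "'w \<Rightarrow> 'w \<Rightarrow> 'f"
  assumes form: "symmetric_bilinear_form s b"
begin

lemma linear_form: "Vector_Spaces.linear s (*) (b x)"
  using form by (simp add: symmetric_bilinear_form_def)

lemma form_commute: "b x y = b y x"
  using form unfolding symmetric_bilinear_form_def by blast

lemma form_add_right: "b x (y + z) = b x y + b x z"
  using linear_form by (simp add: Vector_Spaces.linear_iff)

lemma form_scale_right: "b x (s c y) = c * b x y"
  using linear_form by (simp add: Vector_Spaces.linear_iff)

lemma form_add_left: "b (y + z) x = b y x + b z x"
  by (simp add: form_commute[of _ x] form_add_right)

lemma form_scale_left: "b (s c y) x = c * b y x"
  by (simp add: form_commute[of _ x] form_scale_right)

lemma form_zero_right [simp]: "b x 0 = 0"
  using form_scale_right[of x 0 0] by simp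

lemma form_zero_left [simp]: "b 0 x = 0"
  using form_zero_right form_commute by metis

lemma form_uminus_right: "b x (- y) = - b x y"
  using form_add_right[of x y "- y"] by (simp add: eq_neg_iff_add_eq_0 add.commute)

lemma form_diff_right: "b x (y - z) = b x y - b x z"
  using form_add_right[of x y "- z"] by (simp add: form_uminus_right)

lemma form_diff_left: "b (y - z) x = b y x - b z x"
  by (simp add: form_commute[of _ x] form_diff_right)

lemmas form_simps = form_add_left form_add_right form_scale_left form_scale_right
  form_diff_left form_diff_right

lemma subspace_orthogonal_space: "subspace (orthogonal_space b U)"
  by (rule subspaceI) (auto simp: orthogonal_space_def form_simps)

lemma orthogonal_space_insert:
  "orthogonal_space b (insert u F) = {w \<in> orthogonal_space b F. b u w = 0}"
  by (auto simp: orthogonal_space_def)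

lemma form_eq_zero_on_span:
  assumes "x \<in> span A" "y \<in> span B" "\<And>u v. u \<in> A \<Longrightarrow> v \<in> B \<Longrightarrow> b u v = 0"
  shows "b x y = 0"
proof -
  have *: "b u y = 0" if "u \<in> A" for u
  proof -
    have "b u v = 0" if "v \<in> B" for v
      using assms \<open>u \<in> A\<close> that by blast
    with assms(2) show ?thesis
      by (induction rule: span_induct_alt) (simp_all add: form_simps)
  qed
  from assms(1) show ?thesis
    by (induction rule: span_induct_alt) (simp_all add: form_simps *)
qed

lemma orthogonal_space_span: "orthogonal_space b (span F) = orthogonal_space b F"
proof
  show "orthogonal_space b (span F) \<subseteq> orthogonal_space b F"
    by (auto simp: orthogonal_space_def span_base)
  show "orthogonal_space b F \<subseteq> orthogonal_space b (span F)"
  proof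
    fix w assume "w \<in> orthogonal_space b F"
    then show "w \<in> orthogonal_space b (span F)"
      unfolding orthogonal_space_def
      using form_eq_zero_on_span[of _ F w "{w}"] by (auto simp: span_base)
  qed
qed

lemma totally_isotropic_span:
  assumes "\<And>u v. u \<in> A \<Longrightarrow> v \<in> A \<Longrightarrow> b u v = 0"
  shows "totally_isotropic s b (span A)"
  unfolding totally_isotropic_def using form_eq_zero_on_span[of _ A _ A] assms by blast

lemma totally_isotropic_if_self_orthogonal:
  assumes "orthogonal_space b S = S"
  shows "totally_isotropic s b S"
  unfolding totally_isotropic_def
proof
  show "subspace S"
    using subspace_orthogonal_space[of S] assms by simp
  show "\<forall>x\<in>S. \<forall>y\<in>S. b x y = 0"
    using assms by (auto simp: orthogonal_space_def)
qed

lemma maximal_totally_isotropic_if_self_orthogonal: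
  assumes "orthogonal_space b S = S"
  shows "maximal_totally_isotropic s b S"
  unfolding maximal_totally_isotropic_def
proof (intro conjI allI impI)
  show "totally_isotropic s b S"
    by (rule totally_isotropic_if_self_orthogonal[OF assms])
  fix T assume T: "totally_isotropic s b T \<and> S \<subseteq> T"
  then have "T \<subseteq> orthogonal_space b S"
    by (auto simp: orthogonal_space_def totally_isotropic_def)
  with T assms show "T = S" by auto
qed

text \<open>Adjoining \<open>x\<close> to \<open>S\<close> keeps all pairings zero, because
  \<open>x\<close> is orthogonal to \<open>S\<close> and to itself; by maximality the enlarged span
  is still \<open>S\<close>.\<close>

lemma maximal_totally_isotropic_mem:
  assumes S: "maximal_totally_isotropic s b S"
    and x: "x \<in> orthogonal_space b S" "b x x = 0"
  shows "x \<in> S"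
proof -
  have "totally_isotropic s b (span (insert x S))"
    using S x by (intro totally_isotropic_span)
      (auto simp: maximal_totally_isotropic_def totally_isotropic_def orthogonal_space_def form_commute)
  moreover have "S \<subseteq> span (insert x S)"
    by (meson span_superset subset_insertI subset_trans)
  ultimately have "span (insert x S) = S"
    using S by (auto simp: maximal_totally_isotropic_def)
  then show ?thesis
    by (metis insertI1 span_base)
qed

end

section \<open>Duality and dimension of orthogonal spaces for nondegenerate forms\<close>

locale nondegenerate_form = symmetric_form s b + finite_dimensional_vector_space s Basis
  for s :: "'f::field \<Rightarrow> 'w::ab_group_add \<Rightarrow> 'w" and b and Basis +
  assumes nondegenerate: "nondegenerate b"
begin

lemma eq_zero_if_orthogonal: "(\<And>y. b x y = 0) \<Longrightarrow> x = 0"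
  using nondegenerate by (auto simp: nondegenerate_def radical_def)

text \<open>Finite-dimensional duality: a functional that vanishes on the common kernel of finitely
  many functionals is a combination of them. Induction on \<open>F\<close> removes one generator
  \<open>u\<close> by subtracting a multiple of it from \<open>x\<close>; nondegeneracy is the base
  case.\<close>

lemma mem_span_if_orthogonal:
  assumes "finite F" "\<And>w. w \<in> orthogonal_space b F \<Longrightarrow> b x w = 0"
  shows "x \<in> span F"
  using assms
proof (induction arbitrary: x)
  case empty
  then show ?case
    using eq_zero_if_orthogonal[of x] by (simp add: orthogonal_space_def)
next
  case (insert u F)
  show ?case
  proof (cases "\<exists>w\<in>orthogonal_space b F. b u w \<noteq> 0")
    case True
    then obtain w0 where w0: "w0 \<in> orthogonal_space b F" "b u w0 \<noteq> 0"
      by blast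
    define c where "c = b x w0 / b u w0"
    have "x - s c u \<in> span F"
    proof (rule insert.IH)
      fix w assume w: "w \<in> orthogonal_space b F"
      \<comment> \<open>Subtracting a multiple of \<open>w0\<close> makes \<open>w\<close>
        orthogonal to \<open>u\<close> as well, which brings it into the range of the hypothesis on
        \<open>x\<close>.\<close>
      define w1 where "w1 = w - s (b u w / b u w0) w0"
      have "w1 \<in> orthogonal_space b (insert u F)"
        using w w0 by (auto simp: w1_def orthogonal_space_def form_simps)
      then have "b x w1 = 0"
        by (rule insert.prems)
      then show "b (x - s c u) w = 0"
        by (simp add: w1_def c_def form_simps)
    qed
    then show ?thesis
      by (auto simp: span_insert)
  next
    case False
    \<comment> \<open>Here orthogonality to \<open>u\<close> imposes no new condition.\<close>
    then have "orthogonal_space b F = orthogonal_space b (insert u F)"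
      by (auto simp: orthogonal_space_insert)
    with insert.IH insert.prems have "x \<in> span F" by blast
    then show ?thesis
      by (meson span_mono subset_insertI subsetD)
  qed
qed

lemma orthogonal_space_orthogonal_space:
  assumes "subspace U"
  shows "orthogonal_space b (orthogonal_space b U) = U"
proof
  obtain F where F: "F \<subseteq> U" "independent F" "U \<subseteq> span F"
    using basis_exists[of U] by metis
  then have UF: "U = span F"
    using assms span_subspace by blast
  show "orthogonal_space b (orthogonal_space b U) \<subseteq> U"
  proof
    fix x assume x: "x \<in> orthogonal_space b (orthogonal_space b U)"
    have "x \<in> span F"
    proof (rule mem_span_if_orthogonal)
      show "finite F"
        using F finiteI_independent by blast
      show "b x w = 0" if "w \<in> orthogonal_space b F" for w
        using x that unfolding UF orthogonal_space_span
        by (auto simp: orthogonal_space_def form_commute)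
    qed
    then show "x \<in> U"
      by (simp add: UF)
  qed
  show "U \<subseteq> orthogonal_space b (orthogonal_space b U)"
    by (auto simp: orthogonal_space_def form_commute)
qed

text \<open>Each vector added to an independent set lowers the dimension of the orthogonal space by
  exactly one: by duality some \<open>w0\<close> orthogonal to the old set pairs nontrivially with
  the new vector, and \<open>w0\<close> spans what is lost.\<close>

lemma dim_orthogonal_space: "dim (orthogonal_space b U) + dim U = dim UNIV"
proof -
  have main: "dim (orthogonal_space b F) + card F = dim UNIV" if "finite F" "independent F" for F
    using that
  proof (induction)
    case empty
    then show ?case
      by (simp add: orthogonal_space_def)
  next
    case (insert u F)
    then have ind: "independent F" and u: "u \<notin> span F"
      by (auto simp: independent_insert)
    then obtain w0 where w0: "w0 \<in> orthogonal_space b F" "b u w0 \<noteq> 0"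
      using mem_span_if_orthogonal[of F u] insert.hyps by blast
    let ?Q = "orthogonal_space b (insert u F)"
    have spQ: "span ?Q = ?Q"
      using subspace_orthogonal_space span_eq_iff by blast
    have "orthogonal_space b F = span (insert w0 ?Q)"
    proof
      show "span (insert w0 ?Q) \<subseteq> orthogonal_space b F"
        using w0 by (intro span_minimal subspace_orthogonal_space) (auto simp: orthogonal_space_insert)
      show "orthogonal_space b F \<subseteq> span (insert w0 ?Q)"
      proof
        fix w assume w: "w \<in> orthogonal_space b F"
        have "w - s (b u w / b u w0) w0 \<in> ?Q"
          using w w0 by (auto simp: orthogonal_space_def form_simps)
        then show "w \<in> span (insert w0 ?Q)"
          unfolding span_insert spQ by blast
      qed
    qed
    moreover have "w0 \<notin> span ?Q"
      unfolding spQ using w0 by (simp add: orthogonal_space_insert)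
    ultimately have "dim (orthogonal_space b F) = dim ?Q + 1"
      by (simp add: dim_insert)
    with insert ind show ?case
      by simp
  qed
  obtain F where F: "F \<subseteq> U" "independent F" "U \<subseteq> span F" "card F = dim U"
    using basis_exists[of U] by metis
  then have "span F = span U"
    by (meson span_minimal span_mono subset_antisym subspace_span)
  then have "orthogonal_space b U = orthogonal_space b F"
    by (metis orthogonal_space_span)
  with main[of F] F finiteI_independent show ?thesis
    by simp
qed

section \<open>Complements of a totally isotropic subspace in its orthogonal space\<close>

context
  fixes U K
  assumes U: "totally_isotropic s b U" and K: "is_complement s K U (orthogonal_space b U)"
begin

lemma complement_subset_orthogonal_space: "K \<subseteq> orthogonal_space b U"
proof -
  have "0 + w \<in> orthogonal_space b U" if "w \<in> K" for w
    using K U that subspace_0 unfolding is_complement_def totally_isotropic_def by blast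
  then show ?thesis by auto
qed

text \<open>A vector of \<open>K\<close> orthogonal to \<open>K\<close> is also orthogonal to
  \<open>U\<close>, hence to all of \<open>orthogonal_space b U\<close>. It therefore lies in the
  double orthogonal space \<open>U\<close>, which meets \<open>K\<close> only in zero.\<close>

lemma radical_complement: "radical b K = {0}"
proof -
  have "x = 0" if "x \<in> radical b K" for x
  proof -
    have x: "x \<in> K" "\<And>y. y \<in> K \<Longrightarrow> b x y = 0"
      using that by (auto simp: radical_def)
    have "b x u = 0" if "u \<in> U" for u
      using complement_subset_orthogonal_space x(1) that
      by (auto simp: orthogonal_space_def form_commute)
    then have "x \<in> orthogonal_space b (orthogonal_space b U)"
      using x K by (auto simp: is_complement_def orthogonal_space_def form_simps form_commute[of _ x])
    then have "x \<in> U"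
      using U orthogonal_space_orthogonal_space by (simp add: totally_isotropic_def)
    with x K show "x = 0"
      by (auto simp: is_complement_def)
  qed
  moreover have "0 \<in> radical b K"
    using K subspace_0 by (auto simp: radical_def is_complement_def)
  ultimately show ?thesis by blast
qed

lemma dim_complement: "dim K + 2 * dim U = dim UNIV"
proof -
  have "dim (orthogonal_space b U) + dim (U \<inter> K) = dim U + dim K"
    using dim_sums_Int[of U K] K U by (auto simp: is_complement_def totally_isotropic_def)
  moreover have "dim (U \<inter> K) = 0"
    using K by (simp add: is_complement_def)
  ultimately show ?thesis
    using dim_orthogonal_space[of U] by simp
qed

end

text \<open>A basis \<open>F\<close> of \<open>U\<close> is extended to a basis \<open>G\<close> of
  \<open>X\<close>; the added vectors span a complement, and the trivial intersection follows by
  counting dimensions.\<close>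

lemma exists_complement:
  assumes U: "subspace U" and X: "subspace X" and "U \<subseteq> X"
  obtains K where "is_complement s K U X"
proof -
  obtain F where F: "F \<subseteq> U" "independent F" "U \<subseteq> span F"
    using basis_exists[of U] by metis
  then have spF: "span F = U"
    using U span_subspace by blast
  obtain G where G: "F \<subseteq> G" "G \<subseteq> X" "independent G" "X \<subseteq> span G"
    using maximal_independent_subset_extend[of F X] F assms by (metis subset_trans)
  then have spG: "span G = X"
    using X span_subspace by blast
  have "span (F \<union> (G - F)) = {u + w |u w. u \<in> U \<and> w \<in> span (G - F)}"
    unfolding span_Un spF ..
  then have sums: "X = {u + w |u w. u \<in> U \<and> w \<in> span (G - F)}"
    using G spG by (simp add: Un_absorb1)
  have "is_complement s (span (G - F)) U X"
    unfolding is_complement_def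
  proof (intro conjI)
    have "dim X + dim (U \<inter> span (G - F)) = dim U + dim (span (G - F))"
      using dim_sums_Int[OF U, of "span (G - F)"] sums by simp
    moreover have "dim X = card G" "dim U = card F" "dim (span (G - F)) = card (G - F)"
      using F G spF spG dim_span_eq_card_independent independent_mono by auto
    moreover have "card G = card F + card (G - F)"
      using G finiteI_independent by (metis card_Diff_subset card_mono finite_subset le_add_diff_inverse)
    ultimately have "dim (U \<inter> span (G - F)) = 0"
      by simp
    moreover have "0 \<in> U \<inter> span (G - F)"
      using U subspace_0 span_zero by blast
    ultimately show "U \<inter> span (G - F) = {0}"
      by auto
  qed (use sums in simp_all)
  then show thesis ..
qed

end

subsection \<open>Bases of forms in characteristic 2\<close>

locale char_two_form = nondegenerate_form s b Basis
  for s :: "'f::field \<Rightarrow> 'w::ab_group_add \<Rightarrow> 'w" and b and Basis +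
  assumes char_two: "CHAR('f) = 2" and perfect: "perfect_field TYPE('f)"
begin

lemma two_eq_zero: "(2::'f) = 0"
  using of_nat_CHAR[where ?'a = 'f] char_two by simp

lemma square_add: "(x + y)\<^sup>2 = x\<^sup>2 + (y::'f)\<^sup>2"
  by (simp add: power2_sum two_eq_zero)

lemma add_self: "x + x = (0::'f)"
  using two_eq_zero by (metis mult_2 mult_zero_left)

lemma form_add_self: "b (x + y) (x + y) = b x x + b y y"
  using add_self[of "b x y"] by (simp add: form_simps form_commute[of y x] add.assoc)

text \<open>This is where perfectness enters: the Frobenius map is onto, so every nonzero value
  \<open>b x x\<close> can be scaled to 1.\<close>

lemma exists_square_root: obtains c where "c\<^sup>2 = (a::'f)"
proof -
  have "surj (\<lambda>x::'f. x ^ 2)"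
    using perfect char_two by (simp add: perfect_field_def)
  then have "a \<in> range (\<lambda>x::'f. x ^ 2)"
    by simp
  then show thesis
    using that by auto
qed

lemma exists_unit_multiple:
  assumes "b x x \<noteq> 0"
  obtains c where "b (s c x) (s c x) = 1"
proof -
  obtain c where "c\<^sup>2 = inverse (b x x)"
    by (rule exists_square_root)
  then have "b (s c x) (s c x) = 1"
    using assms by (simp add: form_simps power2_eq_square flip: mult.assoc)
  then show thesis ..
qed

lemma orthogonal_part:
  assumes "subspace K"
  shows "subspace {x \<in> K. b e x = 0}"
  using assms by (auto simp: subspace_def form_simps)

text \<open>Induction step for orthonormal bases. Subtracting \<open>s (b e x) e\<close> projects
  \<open>K\<close> onto \<open>L\<close>, so a vector of \<open>L\<close> orthogonal to
  \<open>L\<close> is orthogonal to all of \<open>K\<close>.\<close>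

lemma split_unit_vector:
  assumes K: "subspace K" "radical b K = {0}" and e: "e \<in> K" "b e e = 1"
  defines "L \<equiv> {x \<in> K. b e x = 0}"
  shows "subspace L" "radical b L = {0}" "span (insert e L) = K" "dim K = Suc (dim L)"
proof -
  show L: "subspace L"
    unfolding L_def by (rule orthogonal_part[OF K(1)])
  then have spL: "span L = L"
    using span_eq_iff by blast
  have proj: "x - s (b e x) e \<in> L" if "x \<in> K" for x
    using that K(1) e by (simp add: L_def form_simps subspace_diff subspace_scale)
  have "x = 0" if x: "x \<in> radical b L" for x
  proof -
    have "b x y = 0" if "y \<in> K" for y
      using x proj[OF that] form_commute[of x e] by (auto simp: radical_def L_def form_simps)
    then have "x \<in> radical b K"
      using x by (simp add: radical_def L_def)
    then show "x = 0"
      using K by simp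
  qed
  moreover have "0 \<in> radical b L"
    using L subspace_0 by (simp add: radical_def)
  ultimately show "radical b L = {0}"
    by blast
  show span: "span (insert e L) = K"
  proof
    show "span (insert e L) \<subseteq> K"
      using K e by (intro span_minimal) (auto simp: L_def)
    show "K \<subseteq> span (insert e L)"
      using proj by (auto simp: span_insert spL)
  qed
  have "e \<notin> span L"
    unfolding spL using e by (simp add: L_def)
  then show "dim K = Suc (dim L)"
    by (metis Suc_eq_plus1 dim_insert dim_span span)
qed

lemma split_hyperbolic_pair:
  assumes K: "subspace K" "radical b K = {0}"
    and ef: "e \<in> K" "f \<in> K" "b e e = 0" "b f f = 0" "b e f = 1"
  defines "L \<equiv> {x \<in> K. b e x = 0 \<and> b f x = 0}"
  shows "subspace L" "radical b L = {0}" "span (insert e (insert f L)) = K" "dim K = dim L + 2"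
proof -
  have fe: "b f e = 1"
    using ef form_commute[of f e] by simp
  have "L = {x \<in> {x \<in> K. b e x = 0}. b f x = 0}"
    by (auto simp: L_def)
  then show L: "subspace L"
    using orthogonal_part[OF orthogonal_part[OF K(1)]] by metis
  then have spL: "span L = L"
    using span_eq_iff by blast
  \<comment> \<open>The coefficients are crossed because \<open>e\<close> and \<open>f\<close> are
    isotropic and pair to 1 with each other.\<close>
  have proj: "x - s (b f x) e - s (b e x) f \<in> L" if "x \<in> K" for x
    using that K(1) ef by (simp add: L_def form_simps subspace_diff subspace_scale fe)
  have "x = 0" if x: "x \<in> radical b L" for x
  proof -
    have "b x y = 0" if "y \<in> K" for y
      using x proj[OF that] form_commute[of x e] form_commute[of x f]
      by (auto simp: radical_def L_def form_simps)
    then have "x \<in> radical b K"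
      using x by (simp add: radical_def L_def)
    then show "x = 0"
      using K by simp
  qed
  moreover have "0 \<in> radical b L"
    using L subspace_0 by (simp add: radical_def)
  ultimately show "radical b L = {0}"
    by blast
  show span: "span (insert e (insert f L)) = K"
  proof
    show "span (insert e (insert f L)) \<subseteq> K"
      using K ef by (intro span_minimal) (auto simp: L_def)
    show "K \<subseteq> span (insert e (insert f L))"
    proof
      fix x assume "x \<in> K"
      from proj[OF this] have "x - s (b f x) e \<in> span (insert f L)"
        unfolding span_insert spL by blast
      then show "x \<in> span (insert e (insert f L))"
        unfolding span_insert[of e] by blast
    qed
  qed
  have "f \<notin> span L"
    unfolding spL using ef by (simp add: L_def)
  \<comment> \<open>Everything in the span of \<open>f\<close> and \<open>L\<close> is orthogonal to
    \<open>f\<close>, while \<open>b f e = 1\<close>; this keeps \<open>e\<close> out of that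
    span.\<close>
  moreover have "b f x = 0" if "x \<in> span (insert f L)" for x
  proof (rule form_eq_zero_on_span)
    show "f \<in> span {f}" "x \<in> span (insert f L)"
      using that by (simp_all add: span_base)
    show "b u v = 0" if "u \<in> {f}" "v \<in> insert f L" for u v
      using that ef by (auto simp: L_def)
  qed
  then have "e \<notin> span (insert f L)"
    using fe by auto
  ultimately show "dim K = dim L + 2"
    using dim_insert[of e "insert f L"] dim_insert[of f L] dim_span[of "insert e (insert f L)"]
    by (simp add: span)
qed

lemma span_image_fun_upd:
  assumes "span (e ` {..<m}) = L"
  shows "span ((e(m := v)) ` {..<Suc m}) = span (insert v L)"
proof -
  have "(e(m := v)) ` {..<Suc m} = insert v (e ` {..<m})"
    by (auto simp: lessThan_Suc)
  moreover have "span L = span (e ` {..<m})"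
    using assms span_span by metis
  ultimately show ?thesis
    by (simp add: span_insert)
qed

text \<open>A careless choice of \<open>e\<close> can leave a nonzero alternating space orthogonal
  to it, in which no further unit vector exists. In that case \<open>e\<close> is replaced by
  \<open>e + z\<close>, where \<open>z\<close>, \<open>y\<close> is a hyperbolic pair in that space;
  the cross term \<open>1 + 1\<close> vanishes in characteristic 2.\<close>

lemma exists_good_unit_vector:
  assumes K: "subspace K" "radical b K = {0}" and x: "x \<in> K" "b x x \<noteq> 0"
  obtains e where "e \<in> K" "b e e = 1"
    "{x \<in> K. b e x = 0} = {0} \<or> (\<exists>y\<in>{x \<in> K. b e x = 0}. b y y \<noteq> 0)"
proof -
  obtain c where c: "b (s c x) (s c x) = 1"
    using x exists_unit_multiple by blast
  define e where "e = s c x"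
  have e: "e \<in> K" "b e e = 1"
    using c x K by (simp_all add: e_def subspace_scale)
  define L where "L = {x \<in> K. b e x = 0}"
  show thesis
  proof (cases "L = {0} \<or> (\<exists>y\<in>L. b y y \<noteq> 0)")
    case True
    then show thesis
      using that e unfolding L_def by blast
  next
    case False
    have L: "subspace L" "radical b L = {0}"
      using split_unit_vector[OF K e] by (simp_all add: L_def)
    then obtain z where z: "z \<in> L" "z \<noteq> 0" "b z z = 0"
      using False subspace_0 by blast
    with L obtain y' where y': "y' \<in> L" "b z y' \<noteq> 0"
      by (auto simp: radical_def)
    define y where "y = s (inverse (b z y')) y'"
    \<comment> \<open>The space orthogonal to \<open>e + z\<close> contains the nonisotropic vector \<open>e + y\<close>.\<close>
    have y: "y \<in> L" "b z y = 1" "b y y = 0"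
      using y' L False by (simp_all add: y_def form_simps subspace_scale)
    have ze: "b z e = 0" "b y e = 0" "b e z = 0" "b e y = 0"
      using z y form_commute by (auto simp: L_def)
    have "e + z \<in> K" "e + y \<in> K"
      using e z y K by (auto simp: L_def subspace_add)
    moreover have "b (e + z) (e + z) = 1" "b (e + y) (e + y) = 1" "b (e + z) (e + y) = 0"
      using e z y ze add_self[of 1] by (simp_all add: form_simps)
    ultimately show thesis
      using that[of "e + z"] by force
  qed
qed

text \<open>Strong induction on the dimension; the third hypothesis is the invariant that the choice
  of a good unit vector restores for its orthogonal part. Bases are indexed by numbers so that bases
  of two spaces can be paired entry by entry.\<close>

lemma exists_orthonormal_basis:
  assumes "subspace K" "radical b K = {0}" "K = {0} \<or> (\<exists>x\<in>K. b x x \<noteq> 0)"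
  shows "\<exists>e. span (e ` {..<dim K}) = K \<and>
    (\<forall>i<dim K. \<forall>j<dim K. b (e i) (e j) = (if i = j then 1 else 0))"
  using assms
proof (induction "dim K" arbitrary: K rule: less_induct)
  case less
  show ?case
  proof (cases "K = {0}")
    case True
    then show ?thesis
      by simp
  next
    case False
    with less.prems obtain v where v: "v \<in> K" "b v v = 1"
      "{x \<in> K. b v x = 0} = {0} \<or> (\<exists>y\<in>{x \<in> K. b v x = 0}. b y y \<noteq> 0)"
      using exists_good_unit_vector[OF less.prems(1,2)] by blast
    define L where "L = {x \<in> K. b v x = 0}"
    note L = split_unit_vector[OF less.prems(1,2) v(1,2), folded L_def]
    obtain e where e: "span (e ` {..<dim L}) = L"
      "\<forall>i<dim L. \<forall>j<dim L. b (e i) (e j) = (if i = j then 1 else 0)"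
      using less.hyps[of L] L v(3) unfolding L_def[symmetric] by auto
    have "e i \<in> L" if "i < dim L" for i
      using that e(1) span_base[of "e i" "e ` {..<dim L}"] by simp
    then have "b v (e i) = 0" "b (e i) v = 0" if "i < dim L" for i
      using that form_commute by (auto simp: L_def)
    with e v have "\<forall>i<dim K. \<forall>j<dim K.
        b ((e(dim L := v)) i) ((e(dim L := v)) j) = (if i = j then 1 else 0)"
      by (auto simp: L less_Suc_eq)
    moreover have "span ((e(dim L := v)) ` {..<dim K}) = K"
      using span_image_fun_upd[OF e(1), of v] L by simp
    ultimately show ?thesis
      by blast
  qed
qed

text \<open>Hyperbolic pairs are split off one at a time, and \<open>i div 2\<close> numbers the
  pair to which index \<open>i\<close> belongs. Evenness of the dimension is proved in the same
  induction, since each new pair has to start at an even index.\<close>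

lemma exists_symplectic_basis:
  assumes "subspace K" "radical b K = {0}" "\<And>x. x \<in> K \<Longrightarrow> b x x = 0"
  shows "even (dim K) \<and> (\<exists>e. span (e ` {..<dim K}) = K \<and>
    (\<forall>i<dim K. \<forall>j<dim K. b (e i) (e j) = (if i \<noteq> j \<and> i div 2 = j div 2 then 1 else 0)))"
  using assms
proof (induction "dim K" arbitrary: K rule: less_induct)
  case less
  show ?case
  proof (cases "K = {0}")
    case True
    then show ?thesis
      by simp
  next
    case False
    then obtain v where v: "v \<in> K" "v \<noteq> 0"
      using less.prems(1) subspace_0 by blast
    then obtain w' where w': "w' \<in> K" "b v w' \<noteq> 0"
      using less.prems(2) by (auto simp: radical_def)
    define w where "w = s (inverse (b v w')) w'"
    have vw: "v \<in> K" "w \<in> K" "b v v = 0" "b w w = 0" "b v w = 1" "b w v = 1"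
      using v w' less.prems(1,3) form_commute[of w' v]
      by (simp_all add: w_def form_simps subspace_scale)
    define L where "L = {x \<in> K. b v x = 0 \<and> b w x = 0}"
    note L = split_hyperbolic_pair[OF less.prems(1,2) vw(1-5), folded L_def]
    have "b x x = 0" if "x \<in> L" for x
      using that less.prems by (simp add: L_def)
    with less.hyps[of L] L obtain e where even: "even (dim L)" and
      e: "span (e ` {..<dim L}) = L"
      "\<forall>i<dim L. \<forall>j<dim L. b (e i) (e j) = (if i \<noteq> j \<and> i div 2 = j div 2 then 1 else 0)"
      by auto
    have "e i \<in> L" if "i < dim L" for i
      using that e(1) span_base[of "e i" "e ` {..<dim L}"] by simp
    then have orth: "b v (e i) = 0" "b (e i) v = 0" "b w (e i) = 0" "b (e i) w = 0"
      if "i < dim L" for i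
      using that form_commute by (auto simp: L_def)
    define f where "f = (e(dim L := w))(Suc (dim L) := v)"
    have "span (f ` {..<Suc (Suc (dim L))}) = span (insert v (span (insert w L)))"
      unfolding f_def by (intro span_image_fun_upd e)
    also have "\<dots> = K"
      using L(3) by (simp only: span_insert[of v] span_span)
    finally have "span (f ` {..<dim K}) = K"
      using L by simp
    \<comment> \<open>As \<open>dim L\<close> is even, its half differs from the half of every
      smaller index, so the new pair shares its number with no old vector.\<close>
    moreover have div: "i div 2 \<noteq> dim L div 2" if "i < dim L" for i
    proof -
      have "i div 2 \<noteq> m div 2" if "i < m" "even m" for m
        using that by presburger
      with that even show ?thesis
        by blast
    qed
    have "b (f i) (f j) = (if i \<noteq> j \<and> i div 2 = j div 2 then 1 else 0)"
      if "i < dim K" "j < dim K" for i j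
    proof -
      have "i < dim L \<or> i = dim L \<or> i = Suc (dim L)" "j < dim L \<or> j = dim L \<or> j = Suc (dim L)"
        using that L by auto
      moreover have "Suc (dim L) div 2 = dim L div 2"
        using even by simp
      ultimately show ?thesis
        using e(2) orth vw div div[symmetric] by (auto simp: f_def)
    qed
    moreover have "even (dim K)"
      using L even by simp
    ultimately show ?thesis
      by blast
  qed
qed

text \<open>For a nonalternating form \<open>u\<close> is the sum of an orthonormal basis:
  \<open>b x x\<close> and the square of \<open>b u x\<close> are both additive in \<open>x\<close>
  and agree on multiples of basis vectors, and \<open>b u u\<close> counts the basis. For an
  alternating form \<open>u = 0\<close> works, because the dimension is even and so vanishes in the
  field.\<close>

lemma exists_characteristic_vector:
  obtains u where "\<And>x. b x x = (b u x)\<^sup>2" "b u u = of_nat (dim UNIV)"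
proof (cases "\<exists>x. b x x \<noteq> 0")
  case True
  have "radical b UNIV = {0}"
    using nondegenerate by (simp add: nondegenerate_def)
  with True exists_orthonormal_basis[of UNIV] obtain e :: "nat \<Rightarrow> 'w" where
    span: "span (e ` {..<dim UNIV}) = UNIV" and
    e: "\<And>i j. i < dim UNIV \<Longrightarrow> j < dim UNIV \<Longrightarrow> b (e i) (e j) = (if i = j then 1 else 0)"
    by (auto simp del: dim_UNIV)
  define u where "u = (\<Sum>i<dim UNIV. e i)"
  have sum: "b x (\<Sum>i\<in>I. e i) = (\<Sum>i\<in>I. b x (e i))" for x I
    by (induction I rule: infinite_finite_induct) (simp_all add: form_simps)
  have ue: "b u (e j) = 1" if "j < dim UNIV" for j
    using that e by (simp add: u_def sum form_commute[of _ "e j"] del: dim_UNIV)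
  have "b u u = (\<Sum>i<dim UNIV. b u (e i))"
    using sum[of u "{..<dim UNIV}"] unfolding u_def .
  also have "\<dots> = (\<Sum>i<dim UNIV. 1)"
    using ue by (intro sum.cong) auto
  finally have "b u u = of_nat (dim UNIV)"
    by simp
  moreover have "b x x = (b u x)\<^sup>2" for x
  proof -
    have "x \<in> span (e ` {..<dim UNIV})"
      unfolding span by simp
    then show ?thesis
    proof (induction rule: span_induct_alt)
      case (step c x y)
      then have "b (s c x) (s c x) = (b u (s c x))\<^sup>2"
        using e ue by (auto simp: form_simps power2_eq_square simp del: dim_UNIV)
      with step show ?case
        by (simp add: form_add_self form_add_right[of u] square_add)
    qed simp
  qed
  ultimately show thesis
    using that by blast
next
  case False
  then have "even (dim UNIV)"
    using exists_symplectic_basis[of UNIV] nondegenerate by (auto simp: nondegenerate_def)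
  then have "of_nat (dim UNIV) = (0::'f)"
    by (simp add: of_nat_eq_0_iff_char_dvd char_two)
  with False show thesis
    by (intro that[of 0]) auto
qed

end

subsection \<open>Isometries\<close>

lemma restrict_comp_isometries:
  assumes "vector_space s" "module.subspace s X"
    and f: "f \<in> isometries s b X s' b' Y" and g: "g \<in> isometries s' b' Y s'' b'' Z"
  shows "restrict (g \<circ> f) X \<in> isometries s b X s'' b'' Z"
proof -
  interpret vector_space s by fact
  have "f x \<in> Y" if "x \<in> X" for x
    using f that by (auto simp: isometries_def bij_betw_def)
  moreover have "bij_betw (g \<circ> f) X Z"
    using f g bij_betw_trans by (auto simp: isometries_def)
  moreover have "bij_betw (restrict (g \<circ> f) X) X Z \<longleftrightarrow> bij_betw (g \<circ> f) X Z"
    by (rule bij_betw_cong) simp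
  ultimately show ?thesis
    using f g assms(2) by (simp add: isometries_def subspace_add subspace_scale)
qed

lemma restrict_inv_into_isometries:
  assumes "vector_space s" "module.subspace s X" and f: "f \<in> isometries s b X s' b' Y"
  shows "restrict (inv_into X f) Y \<in> isometries s' b' Y s b X"
proof -
  interpret vector_space s by fact
  let ?g = "inv_into X f"
  have bij: "bij_betw f X Y"
    using f by (simp add: isometries_def)
  then have g: "?g y \<in> X" "f (?g y) = y" if "y \<in> Y" for y
    using that by (auto simp: bij_betw_def inv_into_into f_inv_into_f)
  have gf: "?g (f x) = x" if "x \<in> X" for x
    using bij that by (simp add: bij_betw_def)
  have fX: "f x \<in> Y" if "x \<in> X" for x
    using bij that by (auto simp: bij_betw_def)
  have add: "y + z \<in> Y \<and> ?g (y + z) = ?g y + ?g z" if "y \<in> Y" "z \<in> Y" for y z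
  proof -
    \<comment> \<open>This equation shows both that \<open>y + z\<close> lies in \<open>Y\<close>
      and what its preimage is.\<close>
    have "f (?g y + ?g z) = y + z"
      using f g that by (simp add: isometries_def)
    moreover have "?g y + ?g z \<in> X"
      using g that assms(2) subspace_add by blast
    ultimately show ?thesis
      using gf fX by metis
  qed
  have scale: "s' c y \<in> Y \<and> ?g (s' c y) = s c (?g y)" if "y \<in> Y" for c y
  proof -
    have "f (s c (?g y)) = s' c y"
      using f g that by (simp add: isometries_def)
    moreover have "s c (?g y) \<in> X"
      using g that assms(2) subspace_scale by blast
    ultimately show ?thesis
      using gf fX by metis
  qed
  have "b (?g y) (?g z) = b' y z" if "y \<in> Y" "z \<in> Y" for y z
  proof -
    have "b' (f (?g y)) (f (?g z)) = b (?g y) (?g z)"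
      using f g(1)[OF that(1)] g(1)[OF that(2)] unfolding isometries_def by blast
    then show ?thesis
      using g that by simp
  qed
  moreover have "bij_betw (restrict ?g Y) Y X \<longleftrightarrow> bij_betw ?g Y X"
    by (rule bij_betw_cong) simp
  then have "bij_betw (restrict ?g Y) Y X"
    using bij_betw_inv_into[OF bij] by blast
  ultimately show ?thesis
    using add scale by (simp add: isometries_def)
qed

text \<open>Composing with the inverse of one fixed isometry \<open>f\<close> turns isometries from
  \<open>X\<close> to \<open>Y\<close> into automorphisms of \<open>X\<close>. Equipollence keeps
  the count meaningful for infinite sets too.\<close>

lemma isometries_eqpoll_isometry_group:
  assumes "vector_space s" "module.subspace s X" and f: "f \<in> isometries s b X s' b' Y"
  shows "isometries s b X s' b' Y \<approx> isometry_group s b X"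
proof -
  define g where "g = restrict (inv_into X f) Y"
  have g: "g \<in> isometries s' b' Y s b X"
    unfolding g_def by (rule restrict_inv_into_isometries[OF assms])
  have bij: "bij_betw f X Y"
    using f by (simp add: isometries_def)
  then have fg: "f (g y) = y" if "y \<in> Y" for y
    using that by (simp add: g_def bij_betw_def f_inv_into_f)
  have gf: "g (f x) = x" if "x \<in> X" for x
    using bij that by (auto simp: g_def bij_betw_def)
  have "bij_betw (\<lambda>h. restrict (g \<circ> h) X) (isometries s b X s' b' Y) (isometries s b X s b X)"
  proof (rule bij_betw_byWitness[where f' = "\<lambda>h. restrict (f \<circ> h) X"])
    show "\<forall>h\<in>isometries s b X s' b' Y. restrict (f \<circ> restrict (g \<circ> h) X) X = h"
    proof
      fix h assume h: "h \<in> isometries s b X s' b' Y"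
      then have "f (g (h x)) = h x" if "x \<in> X" for x
        using h that by (auto simp: isometries_def bij_betw_def intro!: fg)
      then have "restrict (f \<circ> restrict (g \<circ> h) X) X = restrict h X"
        by (intro restrict_ext) simp
      then show "restrict (f \<circ> restrict (g \<circ> h) X) X = h"
        using h by (simp add: isometries_def extensional_restrict)
    qed
    show "\<forall>h\<in>isometries s b X s b X. restrict (g \<circ> restrict (f \<circ> h) X) X = h"
    proof
      fix h assume h: "h \<in> isometries s b X s b X"
      then have "g (f (h x)) = h x" if "x \<in> X" for x
        using h that by (auto simp: isometries_def bij_betw_def intro!: gf)
      then have "restrict (g \<circ> restrict (f \<circ> h) X) X = restrict h X"
        by (intro restrict_ext) simp
      then show "restrict (g \<circ> restrict (f \<circ> h) X) X = h"
        using h by (simp add: isometries_def extensional_restrict)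
    qed
    show "(\<lambda>h. restrict (g \<circ> h) X) ` isometries s b X s' b' Y \<subseteq> isometries s b X s b X"
      using restrict_comp_isometries[OF assms(1,2) _ g] by blast
    show "(\<lambda>h. restrict (f \<circ> h) X) ` isometries s b X s b X \<subseteq> isometries s b X s' b' Y"
      using restrict_comp_isometries[OF assms(1,2) _ f] by blast
  qed
  then show ?thesis
    by (auto simp: isometry_group_def eqpoll_def)
qed

text \<open>The image of a basis of \<open>X\<close> spans \<open>Y\<close>. Applied to an isometry
  and to its inverse, this gives equal dimensions.\<close>

lemma dim_le_if_isometry:
  assumes "finite_dimensional_vector_space s Basis" "vector_space s'"
    and X: "module.subspace s X" and f: "f \<in> isometries s b X s' b' Y"
  shows "vector_space.dim s' Y \<le> vector_space.dim s X"
proof -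
  interpret W: finite_dimensional_vector_space s Basis by fact
  interpret W': vector_space s' by fact
  obtain C where C: "C \<subseteq> X" "W.independent C" "X \<subseteq> W.span C" "card C = W.dim X"
    using W.basis_exists[of X] by metis
  have "f (0 + 0) = f 0 + f 0"
    using f W.subspace_0[OF X] unfolding isometries_def by blast
  then have f0: "f 0 = 0"
    by simp
  \<comment> \<open>Membership in \<open>X\<close> is carried along the induction because
    \<open>f\<close> is additive only on \<open>X\<close>.\<close>
  have "x \<in> X \<and> f x \<in> W'.span (f ` C)" if "x \<in> W.span C" for x
    using that
  proof (induction rule: W.span_induct_alt)
    case base
    then show ?case
      using X f0 W.subspace_0 W'.span_zero by simp
  next
    case (step c x y)
    then have xy: "x \<in> X" "s c x \<in> X" "y \<in> X" "f y \<in> W'.span (f ` C)"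
      using C X W.subspace_scale by auto
    then have "f (s c x + y) = s' c (f x) + f y"
      using f by (simp add: isometries_def)
    with step xy show ?case
      using X by (simp add: W.subspace_add W'.span_add W'.span_scale W'.span_base)
  qed
  then have "f ` X \<subseteq> W'.span (f ` C)"
    using C by blast
  moreover have "f ` X = Y"
    using f by (simp add: isometries_def bij_betw_def)
  moreover have "finite C"
    using C W.finiteI_independent by blast
  ultimately have "W'.dim Y \<le> card (f ` C)" "card (f ` C) \<le> card C"
    by (simp_all add: W'.dim_le_card card_image_le)
  with C show ?thesis
    by simp
qed

section \<open>Isometries as totally isotropic relations\<close>

locale char_two_form_pair =
  W: char_two_form s b Basis + W': char_two_form s' b' Basis'
  for s :: "'f::field \<Rightarrow> 'w::ab_group_add \<Rightarrow> 'w" and b and Basis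
    and s' :: "'f \<Rightarrow> 'v::ab_group_add \<Rightarrow> 'v" and b' and Basis'
begin

sublocale P: vector_space_prod s s'
  by unfold_locales

sublocale V: symmetric_form P.scale "sum_form b b'"
proof
  have "sum_form b b' x (y + z) = sum_form b b' x y + sum_form b b' x z" for x y z
    by (simp add: sum_form_def W.form_simps W'.form_simps)
  moreover have "sum_form b b' x (P.scale c y) = c * sum_form b b' x y" for x c y
    by (simp add: sum_form_def P.scale_def W.form_simps W'.form_simps distrib_left)
  moreover have "sum_form b b' x y = sum_form b b' y x" for x y
    using W.form_commute[of "fst x" "fst y"] W'.form_commute[of "snd x" "snd y"]
    by (simp add: sum_form_def)
  moreover have "vector_space ((*) :: 'f \<Rightarrow> 'f \<Rightarrow> 'f)"
    by unfold_locales (simp_all add: algebra_simps)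
  ultimately show "symmetric_bilinear_form P.scale (sum_form b b')"
    unfolding symmetric_bilinear_form_def Vector_Spaces.linear_iff
    using P.p.vector_space_axioms by metis
qed

lemma eq_if_add_eq_zero: "x + y = 0 \<Longrightarrow> x = (y::'f)"
  using W.add_self[of y] by (metis add_right_cancel)

text \<open>
  As \<open>1 = -1\<close>, the graph of an isometry is totally isotropic for the sum of the two forms.
\<close>

lemma isometry_of_isotropic_relation:
  assumes R: "totally_isotropic P.scale (sum_form b b') R"
    and K: "fst ` R = K" "radical b K = {0}" and K': "snd ` R = K'" "radical b' K' = {0}"
  obtains \<tau> where "\<tau> \<in> isometries s b K s' b' K'" "R = diagonal_subspace K \<tau>"
proof -
  have sub: "P.p.subspace R" and iso: "\<And>x y. x \<in> R \<Longrightarrow> y \<in> R \<Longrightarrow> sum_form b b' x y = 0"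
    using R by (auto simp: totally_isotropic_def)
  have memK: "x \<in> K \<longleftrightarrow> (\<exists>y. (x, y) \<in> R)" for x
    unfolding K(1)[symmetric] by force
  have memK': "y \<in> K' \<longleftrightarrow> (\<exists>x. (x, y) \<in> R)" for y
    unfolding K'(1)[symmetric] by force
  \<comment> \<open>If \<open>(0, y)\<close> lies in \<open>R\<close>, then isotropy makes
    \<open>y\<close> orthogonal to the whole projection \<open>K'\<close>, so \<open>y\<close> is
    radical. Thus \<open>R\<close> is single-valued; the mirror statement \<open>zero_left\<close>
    gives injectivity.\<close>
  have zero_right: "y = 0" if y: "(0, y) \<in> R" for y
  proof -
    have "b' y q = 0" if "(p, q) \<in> R" for p q
      using iso[OF y that] by (simp add: sum_form_def)
    then have "\<forall>q\<in>K'. b' y q = 0"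
      by (auto simp: memK')
    moreover have "y \<in> K'"
      using y memK' by blast
    ultimately have "y \<in> radical b' K'"
      by (simp add: radical_def)
    then show ?thesis
      using K' by simp
  qed
  have zero_left: "x = 0" if x: "(x, 0) \<in> R" for x
  proof -
    have "b x p = 0" if "(p, q) \<in> R" for p q
      using iso[OF x that] by (simp add: sum_form_def)
    then have "\<forall>p\<in>K. b x p = 0"
      by (auto simp: memK)
    moreover have "x \<in> K"
      using x memK by blast
    ultimately have "x \<in> radical b K"
      by (simp add: radical_def)
    then show ?thesis
      using K by simp
  qed
  define \<tau> where "\<tau> = restrict (\<lambda>x. THE y. (x, y) \<in> R) K"
  have mem: "(x, y) \<in> R \<longleftrightarrow> x \<in> K \<and> y = \<tau> x" for x y
  proof -
    have unique: "y = z" if "(x, y) \<in> R" "(x, z) \<in> R" for y z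
      using P.p.subspace_diff[OF sub that] zero_right[of "y - z"] by simp
    have "(x, \<tau> x) \<in> R" if x: "x \<in> K"
    proof -
      have "\<exists>!y. (x, y) \<in> R"
        using x memK unique by blast
      from theI'[OF this] have "(x, THE y. (x, y) \<in> R) \<in> R" .
      then show ?thesis
        using x by (simp add: \<tau>_def)
    qed
    moreover have "x \<in> K" if "(x, y) \<in> R"
      using that memK by blast
    ultimately show ?thesis
      using unique by blast
  qed
  have R_diag: "R = diagonal_subspace K \<tau>"
    using mem by (auto simp: diagonal_subspace_def)
  have "\<tau> \<in> extensional K"
    by (simp add: \<tau>_def)
  moreover have "bij_betw \<tau> K K'"
    unfolding bij_betw_def
  proof
    show "inj_on \<tau> K"
    proof
      fix x y assume "x \<in> K" "y \<in> K" "\<tau> x = \<tau> y"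
      then have "(x, \<tau> x) \<in> R" "(y, \<tau> x) \<in> R"
        by (simp_all add: mem)
      from P.p.subspace_diff[OF sub this] show "x = y"
        using zero_left[of "x - y"] by simp
    qed
    show "\<tau> ` K = K'"
      by (auto simp: memK' mem)
  qed
  moreover have "\<tau> (x + y) = \<tau> x + \<tau> y" if "x \<in> K" "y \<in> K" for x y
    using P.p.subspace_add[OF sub, of "(x, \<tau> x)" "(y, \<tau> y)"] that by (simp add: mem)
  moreover have "\<tau> (s c x) = s' c (\<tau> x)" if "x \<in> K" for c x
    using P.p.subspace_scale[OF sub, of "(x, \<tau> x)" c] that by (simp add: mem P.scale_def)
  moreover have "b' (\<tau> x) (\<tau> y) = b x y" if "x \<in> K" "y \<in> K" for x y
    using iso[of "(x, \<tau> x)" "(y, \<tau> y)"] that eq_if_add_eq_zero[of "b x y" "b' (\<tau> x) (\<tau> y)"]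
    by (simp add: mem sum_form_def)
  ultimately have "\<tau> \<in> isometries s b K s' b' K'"
    by (simp add: isometries_def)
  with R_diag that show thesis
    by blast
qed

text \<open>Dimension and type (alternating or not) determine the form: spaces agreeing in both have
  bases with equal Gram matrices. The pairs \<open>(e i, e' i)\<close> then span a totally isotropic
  relation, which is the graph of the isometry.\<close>

lemma exists_isometry:
  assumes K: "W.subspace K" "radical b K = {0}" and K': "W'.subspace K'" "radical b' K' = {0}"
    and dim: "W.dim K = W'.dim K'"
    and type: "(\<exists>x\<in>K. b x x \<noteq> 0) \<longleftrightarrow> (\<exists>x\<in>K'. b' x x \<noteq> 0)"
  obtains \<tau> where "\<tau> \<in> isometries s b K s' b' K'"
proof -
  define m where "m = W.dim K"
  have m': "m = W'.dim K'"
    by (simp add: m_def dim)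
  obtain e e' where span: "W.span (e ` {..<m}) = K" "W'.span (e' ` {..<m}) = K'"
    and gram: "\<And>i j. i < m \<Longrightarrow> j < m \<Longrightarrow> b (e i) (e j) = b' (e' i) (e' j)"
  proof (cases "\<exists>x\<in>K. b x x \<noteq> 0")
    case True
    with type W.exists_orthonormal_basis[OF K] W'.exists_orthonormal_basis[OF K'] show thesis
      unfolding m_def[symmetric] m'[symmetric] by (metis that)
  next
    case False
    then have "\<And>x. x \<in> K \<Longrightarrow> b x x = 0" "\<And>x. x \<in> K' \<Longrightarrow> b' x x = 0"
      using type by auto
    with W.exists_symplectic_basis[OF K] W'.exists_symplectic_basis[OF K'] show thesis
      unfolding m_def[symmetric] m'[symmetric] by (metis that)
  qed
  define G where "G = (\<lambda>i. (e i, e' i)) ` {..<m}"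
  have "totally_isotropic P.scale (sum_form b b') (P.p.span G)"
  proof (rule V.totally_isotropic_span)
    fix x y assume "x \<in> G" "y \<in> G"
    then show "sum_form b b' x y = 0"
      by (auto simp: G_def sum_form_def gram W.add_self)
  qed
  moreover have "fst ` P.p.span G = W.span (fst ` G)"
    by (rule module_hom.span_image[OF module_prod.module_hom_fst, symmetric]) unfold_locales
  then have "fst ` P.p.span G = K"
    using span by (simp add: G_def image_image)
  moreover have "snd ` P.p.span G = W'.span (snd ` G)"
    by (rule module_hom.span_image[OF module_prod.module_hom_snd, symmetric]) unfold_locales
  then have "snd ` P.p.span G = K'"
    using span by (simp add: G_def image_image)
  ultimately show thesis
    using isometry_of_isotropic_relation K K' that by metis
qed

end

subsection \<open>The characteristic vector\<close>

context char_two_form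
begin

context
  fixes u
  assumes u: "\<And>x. b x x = (b u x)\<^sup>2"
begin

text \<open>The alternating subspace is the orthogonal space of \<open>u\<close>, so by duality its
  radical consists of multiples of \<open>u\<close>: all of them if \<open>b u u = 0\<close>, only
  zero otherwise.\<close>

lemma radical_alternating_subspace_subset_iff:
  assumes U: "subspace U"
  shows "radical b (alternating_subspace b) \<subseteq> U \<longleftrightarrow> b u u \<noteq> 0 \<or> u \<in> U"
proof -
  have alt: "alternating_subspace b = {x. b u x = 0}"
    by (simp add: alternating_subspace_def u)
  have mult: "\<exists>c. x = s c u" if "x \<in> radical b (alternating_subspace b)" for x
  proof -
    have "x \<in> span {u}"
    proof (rule mem_span_if_orthogonal)
      show "b x w = 0" if "w \<in> orthogonal_space b {u}" for w
        using that \<open>x \<in> _\<close> by (simp add: radical_def alt orthogonal_space_def)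
    qed simp
    then show ?thesis
      by (auto simp: span_singleton)
  qed
  show ?thesis
  proof (cases "b u u = 0")
    case True
    then have "u \<in> radical b (alternating_subspace b)"
      by (simp add: radical_def alt)
    then show ?thesis
      using True mult U subspace_scale by blast
  next
    case False
    have "x = 0" if x: "x \<in> radical b (alternating_subspace b)" for x
    proof -
      obtain c where c: "x = s c u"
        using mult x by blast
      then have "c * b u u = 0"
        using x by (simp add: radical_def alt form_simps)
      with False c show ?thesis
        by simp
    qed
    then show ?thesis
      using False U subspace_0 by blast
  qed
qed

text \<open>\<open>K\<close> is alternating when \<open>b u\<close> vanishes on it. Since
  \<open>b u\<close> already vanishes on the totally isotropic \<open>U\<close>, this amounts to
  vanishing on the orthogonal space of \<open>U\<close>, that is, to \<open>u\<close> lying in the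
  double orthogonal space \<open>U\<close>.\<close>

lemma complement_alternating_iff:
  assumes U: "totally_isotropic s b U" and K: "is_complement s K U (orthogonal_space b U)"
  shows "(\<exists>x\<in>K. b x x \<noteq> 0) \<longleftrightarrow> u \<notin> U"
proof -
  have "b u x = 0" if "x \<in> U" for x
    using U that u[of x] by (simp add: totally_isotropic_def)
  then have "b u x = 0" if "x \<in> orthogonal_space b U" "\<forall>w\<in>K. b u w = 0" for x
    using that K by (auto simp: is_complement_def form_simps)
  then have "(\<forall>x\<in>K. b u x = 0) \<longleftrightarrow> (\<forall>x\<in>orthogonal_space b U. b u x = 0)"
    using complement_subset_orthogonal_space[OF U K] by blast
  also have "\<dots> \<longleftrightarrow> u \<in> orthogonal_space b (orthogonal_space b U)"
    by (simp add: orthogonal_space_def[of b "orthogonal_space b U"] form_commute[of _ u])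
  also have "\<dots> \<longleftrightarrow> u \<in> U"
    using U by (simp add: orthogonal_space_orthogonal_space totally_isotropic_def)
  finally show ?thesis
    by (auto simp: u)
qed

end

end

subsection \<open>Self-orthogonal subspaces of the sum\<close>

context char_two_form_pair
begin

text \<open>The vector \<open>(u, u')\<close> is characteristic for the sum, hence orthogonal to
  every isotropic vector, and it is itself isotropic by \<open>parity\<close>; so maximality puts it
  in \<open>S\<close>. Anything orthogonal to \<open>S\<close> is then orthogonal to
  \<open>(u, u')\<close>, hence isotropic, hence in \<open>S\<close>.\<close>

lemma self_orthogonal_if_maximal:
  assumes u: "\<And>x. b x x = (b u x)\<^sup>2" and u': "\<And>x. b' x x = (b' u' x)\<^sup>2"
    and parity: "b u u = b' u' u'"
    and S: "maximal_totally_isotropic P.scale (sum_form b b') S"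
  shows "(u, u') \<in> S" "orthogonal_space (sum_form b b') S = S"
proof -
  have char: "sum_form b b' x x = (sum_form b b' (u, u') x)\<^sup>2" for x
    by (simp add: sum_form_def u[of "fst x"] u'[of "snd x"] W.square_add)
  have iso: "\<And>x y. x \<in> S \<Longrightarrow> y \<in> S \<Longrightarrow> sum_form b b' x y = 0"
    using S by (simp add: maximal_totally_isotropic_def totally_isotropic_def)
  show mem: "(u, u') \<in> S"
  proof (rule V.maximal_totally_isotropic_mem[OF S])
    have "sum_form b b' x (u, u') = 0" if "x \<in> S" for x
      using iso[OF that that] char[of x] V.form_commute[of x "(u, u')"] by simp
    then show "(u, u') \<in> orthogonal_space (sum_form b b') S"
      by (simp add: orthogonal_space_def)
    show "sum_form b b' (u, u') (u, u') = 0"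
      by (simp add: sum_form_def parity W.add_self)
  qed
  have "x \<in> S" if x: "x \<in> orthogonal_space (sum_form b b') S" for x
  proof (rule V.maximal_totally_isotropic_mem[OF S x])
    show "sum_form b b' x x = 0"
      using x mem char[of x] by (simp add: orthogonal_space_def)
  qed
  moreover have "S \<subseteq> orthogonal_space (sum_form b b') S"
    using iso by (auto simp: orthogonal_space_def)
  ultimately show "orthogonal_space (sum_form b b') S = S"
    by blast
qed

section \<open>Slices, projections and decomposition of a self-orthogonal subspace\<close>

context
  fixes S U U'
  assumes S: "orthogonal_space (sum_form b b') S = S"
    and U: "S \<inter> (UNIV \<times> {0}) = U \<times> {0}" and U': "S \<inter> ({0} \<times> UNIV) = {0} \<times> U'"
begin

lemma slice_mem: "x \<in> U \<longleftrightarrow> (x, 0) \<in> S" "y \<in> U' \<longleftrightarrow> (0, y) \<in> S"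
  using U U' by auto

lemma self_orthogonal_form_eq: "x \<in> S \<Longrightarrow> y \<in> S \<Longrightarrow> sum_form b b' x y = 0"
  using V.totally_isotropic_if_self_orthogonal[OF S] by (simp add: totally_isotropic_def)

lemma self_orthogonal_subspace: "P.p.subspace S"
  using V.totally_isotropic_if_self_orthogonal[OF S] by (simp add: totally_isotropic_def)

lemma slice_totally_isotropic: "totally_isotropic s b U" "totally_isotropic s' b' U'"
proof -
  have "W.subspace U"
    using P.p.subspace_0[OF self_orthogonal_subspace] P.p.subspace_add[OF self_orthogonal_subspace, of "(_, 0)" "(_, 0)"]
      P.p.subspace_scale[OF self_orthogonal_subspace, of "(_, 0)"]
    by (intro W.subspaceI) (simp_all add: slice_mem zero_prod_def P.scale_def)
  moreover have "b x y = 0" if "x \<in> U" "y \<in> U" for x y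
    using self_orthogonal_form_eq[of "(x, 0)" "(y, 0)"] that by (simp add: slice_mem sum_form_def)
  ultimately show "totally_isotropic s b U"
    by (simp add: totally_isotropic_def)
  have "W'.subspace U'"
    using P.p.subspace_0[OF self_orthogonal_subspace] P.p.subspace_add[OF self_orthogonal_subspace, of "(0, _)" "(0, _)"]
      P.p.subspace_scale[OF self_orthogonal_subspace, of "(0, _)"]
    by (intro W'.subspaceI) (simp_all add: slice_mem zero_prod_def P.scale_def)
  moreover have "b' x y = 0" if "x \<in> U'" "y \<in> U'" for x y
    using self_orthogonal_form_eq[of "(0, x)" "(0, y)"] that by (simp add: slice_mem sum_form_def)
  ultimately show "totally_isotropic s' b' U'"
    by (simp add: totally_isotropic_def)
qed

text \<open>A vector \<open>w\<close> is orthogonal to the projection of \<open>S\<close> exactly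
  when \<open>(w, 0)\<close> is orthogonal to \<open>S\<close>, that is, when \<open>w\<close> lies
  in \<open>U\<close>. Taking orthogonal spaces once more gives the claim.\<close>

lemma fst_image_self_orthogonal: "fst ` S = orthogonal_space b U"
proof -
  have "W.subspace (fst ` S)"
    by (rule module_hom.subspace_image[OF module_prod.module_hom_fst self_orthogonal_subspace])
      unfold_locales
  then have "orthogonal_space b (orthogonal_space b (fst ` S)) = fst ` S"
    by (rule W.orthogonal_space_orthogonal_space)
  moreover have "w \<in> orthogonal_space b (fst ` S) \<longleftrightarrow> (w, 0) \<in> orthogonal_space (sum_form b b') S" for w
    by (simp add: orthogonal_space_def sum_form_def)
  then have "orthogonal_space b (fst ` S) = U"
    by (simp only: S slice_mem set_eq_iff simp_thms)
  ultimately show ?thesis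
    by simp
qed

lemma snd_image_self_orthogonal: "snd ` S = orthogonal_space b' U'"
proof -
  have "W'.subspace (snd ` S)"
    by (rule module_hom.subspace_image[OF module_prod.module_hom_snd self_orthogonal_subspace])
      unfold_locales
  then have "orthogonal_space b' (orthogonal_space b' (snd ` S)) = snd ` S"
    by (rule W'.orthogonal_space_orthogonal_space)
  moreover have "w \<in> orthogonal_space b' (snd ` S) \<longleftrightarrow> (0, w) \<in> orthogonal_space (sum_form b b') S" for w
    by (simp add: orthogonal_space_def sum_form_def)
  then have "orthogonal_space b' (snd ` S) = U'"
    by (simp only: S slice_mem set_eq_iff simp_thms)
  ultimately show ?thesis
    by simp
qed

text \<open>Each vector of \<open>S\<close> has the form \<open>(x + p, y + q)\<close> with
  \<open>x\<close>, \<open>y\<close> in the slices and \<open>p\<close>, \<open>q\<close> in the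
  complements. Removing \<open>(x, y)\<close>, itself in \<open>S\<close>, leaves a vector of
  \<open>S \<inter> (K \<times> K')\<close>, and this intersection is the graph of an
  isometry.\<close>

lemma self_orthogonal_decomposition:
  assumes K: "is_complement s K U (orthogonal_space b U)"
    and K': "is_complement s' K' U' (orthogonal_space b' U')"
  shows "\<exists>!\<tau>. \<tau> \<in> isometries s b K s' b' K' \<and>
    orthogonal_direct_sum (sum_form b b') S (U \<times> {0}) (diagonal_subspace K \<tau>) ({0} \<times> U')"
proof -
  note sub = self_orthogonal_subspace
  have mem: "(x + p, y + q) \<in> S \<longleftrightarrow> (p, q) \<in> S" if "x \<in> U" "y \<in> U'" for x y p q
  proof -
    have xy: "(x, y) \<in> S"
      using P.p.subspace_add[OF sub, of "(x, 0)" "(0, y)"] that by (simp add: slice_mem)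
    show ?thesis
      using P.p.subspace_add[OF sub xy, of "(p, q)"] P.p.subspace_diff[OF sub _ xy, of "(x + p, y + q)"]
      by auto
  qed
  have decomp: "\<exists>x p y q. x \<in> U \<and> p \<in> K \<and> y \<in> U' \<and> q \<in> K' \<and> z = (x + p, y + q)" if "z \<in> S" for z
  proof -
    have "fst z \<in> orthogonal_space b U" "snd z \<in> orthogonal_space b' U'"
      using that fst_image_self_orthogonal snd_image_self_orthogonal by blast+
    then obtain x p y q where "x \<in> U" "p \<in> K" "fst z = x + p" "y \<in> U'" "q \<in> K'" "snd z = y + q"
      using K K' by (auto simp: is_complement_def)
    then show ?thesis
      by (intro exI[of _ x] exI[of _ p] exI[of _ y] exI[of _ q]) (simp add: prod_eq_iff)
  qed
  have zero: "0 \<in> U" "0 \<in> U'"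
    using slice_totally_isotropic W.subspace_0 W'.subspace_0 by (auto simp: totally_isotropic_def)
  define R where "R = S \<inter> (K \<times> K')"
  have "totally_isotropic P.scale (sum_form b b') R"
    using K K' sub P.subspace_Times self_orthogonal_form_eq
    by (auto simp: R_def totally_isotropic_def is_complement_def intro!: P.p.subspace_inter)
  moreover have "fst ` R = K"
  proof
    \<comment> \<open>A lift \<open>(w, v)\<close> of \<open>w\<close> to \<open>S\<close> exists by
      the projection lemma; changing \<open>v\<close> by an element of \<open>U'\<close> moves it
      into \<open>K'\<close> without leaving \<open>S\<close>.\<close>
    show "K \<subseteq> fst ` R"
    proof
      fix w assume w: "w \<in> K"
      then have "w \<in> fst ` S"
        using W.complement_subset_orthogonal_space[OF slice_totally_isotropic(1) K]
        by (auto simp: fst_image_self_orthogonal)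
      then obtain v where v: "(w, v) \<in> S"
        by force
      from decomp[OF this] obtain y q where "y \<in> U'" "q \<in> K'" "v = y + q"
        by auto
      with mem[of 0 y w q] v w zero have "(w, q) \<in> R"
        by (simp add: R_def)
      then show "w \<in> fst ` R"
        by force
    qed
  qed (auto simp: R_def)
  moreover have "snd ` R = K'"
  proof
    show "K' \<subseteq> snd ` R"
    proof
      fix v assume v: "v \<in> K'"
      then have "v \<in> snd ` S"
        using W'.complement_subset_orthogonal_space[OF slice_totally_isotropic(2) K']
        by (auto simp: snd_image_self_orthogonal)
      then obtain w where w: "(w, v) \<in> S"
        by force
      from decomp[OF this] obtain x p where "x \<in> U" "p \<in> K" "w = x + p"
        by auto
      with mem[of x 0 p v] v w zero have "(p, v) \<in> R"
        by (simp add: R_def)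
      then show "v \<in> snd ` R"
        by force
    qed
  qed (auto simp: R_def)
  ultimately obtain \<tau> where \<tau>: "\<tau> \<in> isometries s b K s' b' K'" and R: "R = diagonal_subspace K \<tau>"
    using isometry_of_isotropic_relation W.radical_complement[OF slice_totally_isotropic(1) K]
      W'.radical_complement[OF slice_totally_isotropic(2) K'] by metis
  show ?thesis
  proof (rule ex1I[of _ \<tau>])
    show "\<tau> \<in> isometries s b K s' b' K' \<and>
      orthogonal_direct_sum (sum_form b b') S (U \<times> {0}) (diagonal_subspace K \<tau>) ({0} \<times> U')"
      (is "_ \<and> ?sum")
    proof
      have S_eq: "S = {x + y + z |x y z. x \<in> U \<times> {0} \<and> y \<in> R \<and> z \<in> {0} \<times> U'}"
      proof (intro equalityI subsetI)
        fix z assume z: "z \<in> S"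
        from decomp[OF this] obtain x p y q where
          xy: "x \<in> U" "p \<in> K" "y \<in> U'" "q \<in> K'" "z = (x + p, y + q)"
          by blast
        with mem z have "(p, q) \<in> R"
          by (simp add: R_def)
        moreover have "z = (x, 0) + (p, q) + (0, y)"
          using xy by (simp add: add.commute)
        ultimately show "z \<in> {x + y + z |x y z. x \<in> U \<times> {0} \<and> y \<in> R \<and> z \<in> {0} \<times> U'}"
          using xy by blast
      next
        fix z assume "z \<in> {x + y + z |x y z. x \<in> U \<times> {0} \<and> y \<in> R \<and> z \<in> {0} \<times> U'}"
        then obtain x p q y where "x \<in> U" "(p, q) \<in> R" "y \<in> U'" "z = (x + p, q + y)"
          by auto
        then show "z \<in> S"
          using mem[of x y p q] by (simp add: R_def add.commute)
      qed
      have direct: "x = 0 \<and> y = 0 \<and> z = 0"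
        if prems: "x \<in> U \<times> {0}" "y \<in> R" "z \<in> {0} \<times> U'" "x + y + z = 0" for x y z
      proof -
        obtain x1 p q z1 where xyz: "x = (x1, 0)" "y = (p, q)" "z = (0, z1)"
          "x1 \<in> U" "p \<in> K" "q \<in> K'" "z1 \<in> U'" "x1 + p = 0" "q + z1 = 0"
          using prems by (cases x; cases y; cases z) (auto simp: R_def zero_prod_def)
        then have "p = - x1" "q = - z1"
          by (simp_all add: eq_neg_iff_add_eq_0 add.commute)
        then have "p \<in> U" "q \<in> U'"
          using xyz slice_totally_isotropic W.subspace_neg W'.subspace_neg
          by (auto simp: totally_isotropic_def)
        then have "p = 0" "q = 0"
          using xyz K K' by (auto simp: is_complement_def)
        then show ?thesis
          using xyz by (simp add: zero_prod_def)
      qed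
      have "U \<times> {0} \<subseteq> S" "R \<subseteq> S" "{0} \<times> U' \<subseteq> S"
        by (auto simp: slice_mem R_def)
      then have "sum_form b b' x y = 0"
        if "x \<in> U \<times> {0} \<or> x \<in> R" "y \<in> R \<or> y \<in> {0} \<times> U'" for x y
        using that self_orthogonal_form_eq by blast
      then show ?sum
        unfolding orthogonal_direct_sum_def R[symmetric]
        by (intro conjI ballI impI S_eq) (use direct in blast)+
    qed (rule \<tau>)
    fix \<rho>
    assume \<rho>: "\<rho> \<in> isometries s b K s' b' K' \<and>
      orthogonal_direct_sum (sum_form b b') S (U \<times> {0}) (diagonal_subspace K \<rho>) ({0} \<times> U')"
    \<comment> \<open>The graph of any competing isometry lies in \<open>S\<close> and in
      \<open>K \<times> K'\<close>, hence in \<open>R\<close>, the graph of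
      \<open>\<tau>\<close>.\<close>
    have "\<rho> w = \<tau> w" if w: "w \<in> K" for w
    proof -
      have "(0, 0) + (w, \<rho> w) + (0, 0) \<in> S"
        using \<rho> w zero unfolding orthogonal_direct_sum_def diagonal_subspace_def by blast
      moreover have "\<rho> w \<in> K'"
        using \<rho> w by (auto simp: isometries_def bij_betw_def)
      ultimately have "(w, \<rho> w) \<in> R"
        using w by (simp add: R_def)
      then show ?thesis
        by (auto simp: R diagonal_subspace_def)
    qed
    then show "\<rho> = \<tau>"
      using \<rho> \<tau> by (auto simp: isometries_def intro: extensionalityI)
  qed
qed

text \<open>Complements \<open>K\<close> and \<open>K'\<close> are chosen only to obtain an isometry
  between them; their equal dimensions are \<open>n - 2k\<close> and
  \<open>n' - 2k'\<close>.\<close>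

lemma self_orthogonal_dim_eq:
  "int (W.dim UNIV) - int (W'.dim UNIV) = 2 * (int (W.dim U) - int (W'.dim U'))"
proof -
  have U_sub: "W.subspace U" "U \<subseteq> orthogonal_space b U" "W'.subspace U'" "U' \<subseteq> orthogonal_space b' U'"
    using slice_totally_isotropic by (auto simp: totally_isotropic_def orthogonal_space_def)
  obtain K where K: "is_complement s K U (orthogonal_space b U)"
    using W.exists_complement[OF U_sub(1) W.subspace_orthogonal_space U_sub(2)] .
  obtain K' where K': "is_complement s' K' U' (orthogonal_space b' U')"
    using W'.exists_complement[OF U_sub(3) W'.subspace_orthogonal_space U_sub(4)] .
  obtain \<tau> where \<tau>: "\<tau> \<in> isometries s b K s' b' K'"
    using self_orthogonal_decomposition[OF K K'] by blast
  have sub: "W.subspace K" "W'.subspace K'"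
    using K K' by (simp_all add: is_complement_def)
  have "W'.dim K' \<le> W.dim K"
    using dim_le_if_isometry[OF W.finite_dimensional_vector_space_axioms W'.vector_space_axioms sub(1) \<tau>] .
  moreover have "W.dim K \<le> W'.dim K'"
    using dim_le_if_isometry[OF W'.finite_dimensional_vector_space_axioms W.vector_space_axioms sub(2)
        restrict_inv_into_isometries[OF W.vector_space_axioms sub(1) \<tau>]] .
  ultimately show ?thesis
    using W.dim_complement[OF slice_totally_isotropic(1) K]
      W'.dim_complement[OF slice_totally_isotropic(2) K'] by simp
qed

end

end

section \<open>Gluing isometries to maximal totally isotropic subspaces\<close>

context char_two_form_pair
begin

context
  fixes U U' K K'
  assumes U: "totally_isotropic s b U" and U': "totally_isotropic s' b' U'"
    and K: "is_complement s K U (orthogonal_space b U)"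
    and K': "is_complement s' K' U' (orthogonal_space b' U')"
begin

lemma zero_mem: "0 \<in> U" "0 \<in> U'" "0 \<in> K" "0 \<in> K'"
  using U U' K K' W.subspace_0 W'.subspace_0 by (auto simp: totally_isotropic_def is_complement_def)

text \<open>The only candidate for \<open>S\<close> with a given \<open>\<tau>\<close>, written in
  coordinates so that orthogonality can be computed directly.\<close>

definition glue :: "('w \<Rightarrow> 'v) \<Rightarrow> ('w \<times> 'v) set"
  where "glue \<tau> = {(u + w, \<tau> w + u') |u w u'. u \<in> U \<and> w \<in> K \<and> u' \<in> U'}"

lemma eq_glue_if_orthogonal_direct_sum:
  assumes "orthogonal_direct_sum (sum_form b b') S (U \<times> {0}) (diagonal_subspace K \<tau>) ({0} \<times> U')"
  shows "S = glue \<tau>"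
proof -
  have "S = {x + y + z |x y z. x \<in> U \<times> {0} \<and> y \<in> diagonal_subspace K \<tau> \<and> z \<in> {0} \<times> U'}"
    using assms by (simp add: orthogonal_direct_sum_def)
  also have "\<dots> = glue \<tau>"
  proof (intro equalityI subsetI)
    fix z assume "z \<in> glue \<tau>"
    then obtain u w u' where z: "u \<in> U" "w \<in> K" "u' \<in> U'" "z = (u, 0) + (w, \<tau> w) + (0, u')"
      by (auto simp: glue_def)
    moreover have "(w, \<tau> w) \<in> diagonal_subspace K \<tau>"
      using z by (auto simp: diagonal_subspace_def)
    ultimately show "z \<in> {x + y + z |x y z. x \<in> U \<times> {0} \<and> y \<in> diagonal_subspace K \<tau> \<and> z \<in> {0} \<times> U'}"
      by blast
  next
    fix z assume "z \<in> {x + y + z |x y z. x \<in> U \<times> {0} \<and> y \<in> diagonal_subspace K \<tau> \<and> z \<in> {0} \<times> U'}"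
    then show "z \<in> glue \<tau>"
      by (auto simp: glue_def diagonal_subspace_def)
  qed
  finally show ?thesis .
qed

context
  fixes \<tau>
  assumes \<tau>: "\<tau> \<in> isometries s b K s' b' K'"
begin

lemma isometry_zero: "\<tau> 0 = 0"
proof -
  have "\<tau> (0 + 0) = \<tau> 0 + \<tau> 0"
    using \<tau> zero_mem unfolding isometries_def by blast
  then show ?thesis
    by simp
qed

lemma isometry_eq_zero:
  assumes "w \<in> K" "\<tau> w = 0"
  shows "w = 0"
proof -
  have "inj_on \<tau> K"
    using \<tau> by (simp add: isometries_def bij_betw_def)
  then show ?thesis
    using assms zero_mem isometry_zero by (metis inj_onD)
qed

lemma isometry_mem: "w \<in> K \<Longrightarrow> \<tau> w \<in> K'"
  using \<tau> by (auto simp: isometries_def bij_betw_def)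

lemma isometry_form: "x \<in> K \<Longrightarrow> y \<in> K \<Longrightarrow> b' (\<tau> x) (\<tau> y) = b x y"
  using \<tau> by (simp add: isometries_def)

text \<open>If the second coordinate is zero, then \<open>\<tau> w\<close> lies in
  \<open>U' \<inter> K'\<close>, so it vanishes and with it \<open>w\<close>. If the first is zero,
  \<open>w\<close> lies in \<open>U \<inter> K\<close>.\<close>

lemma glue_slices: "glue \<tau> \<inter> (UNIV \<times> {0}) = U \<times> {0}" "glue \<tau> \<inter> ({0} \<times> UNIV) = {0} \<times> U'"
proof -
  have left: "w = 0" if "w \<in> K" "u' \<in> U'" "\<tau> w + u' = 0" for w u'
  proof -
    have "\<tau> w = - u'"
      using that by (simp add: eq_neg_iff_add_eq_0)
    moreover have "- u' \<in> U'"
      using that U' W'.subspace_neg by (auto simp: totally_isotropic_def)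
    ultimately have "\<tau> w \<in> U' \<inter> K'"
      using that isometry_mem[of w] by simp
    then have "\<tau> w = 0"
      using K' unfolding is_complement_def by blast
    then show "w = 0"
      using isometry_eq_zero that by blast
  qed
  have right: "w = 0" if "w \<in> K" "u \<in> U" "u + w = 0" for w u
  proof -
    have "w = - u"
      using that by (simp add: eq_neg_iff_add_eq_0 add.commute)
    then have "w \<in> U \<inter> K"
      using that U W.subspace_neg by (auto simp: totally_isotropic_def)
    then show "w = 0"
      using K unfolding is_complement_def by blast
  qed
  show "glue \<tau> \<inter> (UNIV \<times> {0}) = U \<times> {0}"
  proof (intro equalityI subsetI)
    fix z assume "z \<in> glue \<tau> \<inter> (UNIV \<times> {0})"
    then obtain u w u' where z: "u \<in> U" "w \<in> K" "u' \<in> U'" "\<tau> w + u' = 0" "z = (u + w, 0)"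
      by (auto simp: glue_def)
    with left[of w u'] show "z \<in> U \<times> {0}"
      by simp
  next
    fix z :: "'w \<times> 'v" assume "z \<in> U \<times> {0}"
    then obtain u where u: "u \<in> U" "z = (u + 0, \<tau> 0 + 0)"
      using isometry_zero by auto
    then have "z \<in> glue \<tau>"
      using zero_mem unfolding glue_def by blast
    with u show "z \<in> glue \<tau> \<inter> (UNIV \<times> {0})"
      by (simp add: isometry_zero)
  qed
  show "glue \<tau> \<inter> ({0} \<times> UNIV) = {0} \<times> U'"
  proof (intro equalityI subsetI)
    fix z assume "z \<in> glue \<tau> \<inter> ({0} \<times> UNIV)"
    then obtain u w u' where z: "u \<in> U" "w \<in> K" "u' \<in> U'" "u + w = 0" "z = (0, \<tau> w + u')"
      by (auto simp: glue_def)
    with right[of w u] isometry_zero show "z \<in> {0} \<times> U'"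
      by simp
  next
    fix z :: "'w \<times> 'v" assume "z \<in> {0} \<times> U'"
    then obtain u' where u': "u' \<in> U'" "z = (0 + 0, \<tau> 0 + u')"
      using isometry_zero by auto
    then have "z \<in> glue \<tau>"
      using zero_mem unfolding glue_def by blast
    with u' show "z \<in> glue \<tau> \<inter> ({0} \<times> UNIV)"
      by simp
  qed
qed

text \<open>All pairings involving the \<open>U\<close> and \<open>U'\<close> parts vanish, which
  reduces the question to the graph inside \<open>K \<times> K'\<close>. There isotropy is
  \<open>1 + 1 = 0\<close>, and the converse inclusion follows from nondegeneracy of
  \<open>K'\<close>.\<close>

lemma glue_self_orthogonal: "orthogonal_space (sum_form b b') (glue \<tau>) = glue \<tau>"
proof
  have Uperp: "b x y = 0" "b y x = 0" if "x \<in> U" "y \<in> orthogonal_space b U" for x y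
    using that by (auto simp: orthogonal_space_def W.form_commute)
  have U'perp: "b' x y = 0" "b' y x = 0" if "x \<in> U'" "y \<in> orthogonal_space b' U'" for x y
    using that by (auto simp: orthogonal_space_def W'.form_commute)
  have UU: "U \<subseteq> orthogonal_space b U" "U' \<subseteq> orthogonal_space b' U'"
    using U U' by (auto simp: totally_isotropic_def orthogonal_space_def)
  note KU = W.complement_subset_orthogonal_space[OF U K]
    and KU' = W'.complement_subset_orthogonal_space[OF U' K']
  have form: "sum_form b b' (u + w, v + u') (x + y, z + x') = b w y + b' v z"
    if "u \<in> U" "w \<in> K" "v \<in> K'" "u' \<in> U'" "x \<in> U" "y \<in> K" "z \<in> K'" "x' \<in> U'"
    for u w v u' x y z x'
  proof -
    have "b u x = 0" "b u y = 0" "b w x = 0" "b' u' x' = 0" "b' v x' = 0" "b' u' z = 0"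
      using that by (simp_all add: Uperp U'perp subsetD[OF UU(1)] subsetD[OF UU(2)]
          subsetD[OF KU] subsetD[OF KU'])
    then show ?thesis
      by (simp add: sum_form_def W.form_simps W'.form_simps)
  qed
  show "glue \<tau> \<subseteq> orthogonal_space (sum_form b b') (glue \<tau>)"
    by (auto simp: glue_def orthogonal_space_def form isometry_mem isometry_form W.add_self)
  show "orthogonal_space (sum_form b b') (glue \<tau>) \<subseteq> glue \<tau>"
  proof
    fix z assume z: "z \<in> orthogonal_space (sum_form b b') (glue \<tau>)"
    obtain z1 z2 where z12: "z = (z1, z2)"
      by fastforce
    have glueI: "(u + w, \<tau> w + u') \<in> glue \<tau>" if "u \<in> U" "w \<in> K" "u' \<in> U'" for u w u'
      using that by (auto simp: glue_def)
    have orth: "b (u + w) z1 + b' (\<tau> w + u') z2 = 0" if "u \<in> U" "w \<in> K" "u' \<in> U'" for u w u'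
      using z glueI[OF that] by (auto simp: orthogonal_space_def z12 sum_form_def)
    \<comment> \<open>Testing \<open>z\<close> against \<open>(u, 0)\<close>, and below against
      \<open>(0, u')\<close>, gives the orthogonality needed to split its coordinates.\<close>
    have "z1 \<in> orthogonal_space b U"
      using orth[of _ 0 0] zero_mem isometry_zero by (simp add: orthogonal_space_def)
    then obtain u w where uw: "u \<in> U" "w \<in> K" "z1 = u + w"
      using K by (auto simp: is_complement_def)
    have "z2 \<in> orthogonal_space b' U'"
      using orth[of 0 0] zero_mem isometry_zero by (simp add: orthogonal_space_def)
    then obtain u' v where uv: "u' \<in> U'" "v \<in> K'" "z2 = v + u'"
      using K' by (auto simp: is_complement_def add.commute)
    \<comment> \<open>By surjectivity each \<open>y\<close> in \<open>K'\<close> is some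
      \<open>\<tau> x\<close>, so \<open>z\<close> can be tested against the graph vector
      \<open>(x, y)\<close>.\<close>
    have "b' (v - \<tau> w) y = 0" if y: "y \<in> K'" for y
    proof -
      obtain x where x: "x \<in> K" "y = \<tau> x"
        using y \<tau> by (auto simp: isometries_def bij_betw_def)
      have "b x w + b' y v = 0"
        using orth[of 0 x 0] form[of 0 x y 0 u w v u'] x uw uv zero_mem that
        by (simp add: sum_form_def)
      moreover have "b x w = b' y (\<tau> w)"
        using isometry_form x uw by simp
      ultimately show ?thesis
        using eq_if_add_eq_zero[of "b' y (\<tau> w)" "b' y v"]
        by (simp add: W'.form_simps W'.form_commute[of _ y])
    qed
    moreover have "v - \<tau> w \<in> K'"
      using uv uw isometry_mem K' W'.subspace_diff by (auto simp: is_complement_def)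
    ultimately have "v - \<tau> w \<in> radical b' K'"
      by (simp add: radical_def)
    then have "v = \<tau> w"
      using W'.radical_complement[OF U' K'] by simp
    then show "z \<in> glue \<tau>"
      using glueI[of u w u'] uw uv z12 by simp
  qed
qed

end

text \<open>Surjectivity is the decomposition of a maximal \<open>S\<close>. For injectivity, two
  isometries with the same glued space differ at \<open>w\<close> by an element of
  \<open>U' \<inter> K'\<close>, which is zero.\<close>

lemma bij_betw_glue:
  assumes u: "\<And>x. b x x = (b u x)\<^sup>2" and u': "\<And>x. b' x x = (b' u' x)\<^sup>2"
    and parity: "b u u = b' u' u'"
  shows "bij_betw glue (isometries s b K s' b' K')
    {S. maximal_totally_isotropic P.scale (sum_form b b') S \<and>
      S \<inter> (UNIV \<times> {0}) = U \<times> {0} \<and> S \<inter> ({0} \<times> UNIV) = {0} \<times> U'}"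
    (is "bij_betw glue ?I ?S")
proof -
  have ex1: "\<exists>!\<tau>. \<tau> \<in> ?I \<and> orthogonal_direct_sum (sum_form b b') S
      (U \<times> {0}) (diagonal_subspace K \<tau>) ({0} \<times> U')" if "S \<in> ?S" for S
  proof -
    have S: "maximal_totally_isotropic P.scale (sum_form b b') S"
      "S \<inter> (UNIV \<times> {0}) = U \<times> {0}" "S \<inter> ({0} \<times> UNIV) = {0} \<times> U'"
      using that by simp_all
    show ?thesis
      by (rule self_orthogonal_decomposition[OF self_orthogonal_if_maximal(2)[OF u u' parity S(1)]
            S(2,3) K K'])
  qed
  have maps: "glue \<tau> \<in> ?S" if "\<tau> \<in> ?I" for \<tau>
    by (intro CollectI conjI glue_slices[OF that]
        V.maximal_totally_isotropic_if_self_orthogonal[OF glue_self_orthogonal[OF that]])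
  show ?thesis
    unfolding bij_betw_def
  proof
    show "inj_on glue ?I"
    proof
      fix \<tau> \<rho> assume \<tau>: "\<tau> \<in> ?I" and \<rho>: "\<rho> \<in> ?I" and glue: "glue \<tau> = glue \<rho>"
      have "\<rho> w = \<tau> w" if w: "w \<in> K" for w
      proof -
        have "(0 + w, \<tau> w + 0) \<in> glue \<tau>" "(0 + w, \<rho> w + 0) \<in> glue \<rho>"
          unfolding glue_def using zero_mem w by blast+
        moreover have "P.p.subspace (glue \<tau>)"
          using maps[OF \<tau>] by (simp add: maximal_totally_isotropic_def totally_isotropic_def)
        ultimately have "(0, \<rho> w - \<tau> w) \<in> glue \<tau>"
          using P.p.subspace_diff[of "glue \<tau>" "(w, \<rho> w)" "(w, \<tau> w)"] glue by simp
        then have "\<rho> w - \<tau> w \<in> U'"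
          using glue_slices(2)[OF \<tau>] by blast
        moreover have "\<rho> w - \<tau> w \<in> K'"
          using isometry_mem[OF \<tau> w] isometry_mem[OF \<rho> w] K' W'.subspace_diff
          by (auto simp: is_complement_def)
        ultimately have "\<rho> w - \<tau> w = 0"
          using K' unfolding is_complement_def by blast
        then show ?thesis
          by simp
      qed
      then show "\<tau> = \<rho>"
        using \<rho> \<tau> by (auto simp: isometries_def intro: extensionalityI)
    qed
    show "glue ` ?I = ?S"
    proof
      show "glue ` ?I \<subseteq> ?S"
        using maps by blast
      show "?S \<subseteq> glue ` ?I"
        using ex1 eq_glue_if_orthogonal_direct_sum by blast
    qed
  qed
qed

end

end

theorem theoremA13:
  fixes s :: "'f::field \<Rightarrow> 'w::ab_group_add \<Rightarrow> 'w"
    and s' :: "'f \<Rightarrow> 'v::ab_group_add \<Rightarrow> 'v"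
    and b :: "'w \<Rightarrow> 'w \<Rightarrow> 'f"
    and b' :: "'v \<Rightarrow> 'v \<Rightarrow> 'f"
    and Basis :: "'w set" and Basis' :: "'v set"
    and n n' :: nat
  assumes "perfect_field TYPE('f)" and "CHAR('f) = 2"
    and "finite_dimensional_vector_space s Basis"
    and "finite_dimensional_vector_space s' Basis'"
    and "vector_space.dim s UNIV = n" and "n \<ge> 1"
    and "vector_space.dim s' UNIV = n'" and "n' \<ge> 1"
    and "symmetric_bilinear_form s b" and "nondegenerate b"
    and "symmetric_bilinear_form s' b'" and "nondegenerate b'"
    and "even n \<longleftrightarrow> even n'"
  shows
    "(\<forall>S U U' k k'.
        maximal_totally_isotropic (module_prod.scale s s') (sum_form b b') S \<and>
        S \<inter> (UNIV \<times> {0}) = U \<times> {0} \<and> vector_space.dim s U = k \<and>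
        S \<inter> ({0} \<times> UNIV) = {0} \<times> U' \<and> vector_space.dim s' U' = k'
      \<longrightarrow>
        int n - int n' = 2 * (int k - int k') \<and>
        compatible_isotropy_types b b' U U' \<and>
        (\<forall>K K'. is_complement s K U (orthogonal_space b U) \<and>
                is_complement s' K' U' (orthogonal_space b' U') \<longrightarrow>
          (\<exists>!\<tau>. \<tau> \<in> isometries s b K s' b' K' \<and>
             orthogonal_direct_sum (sum_form b b') S
               (U \<times> {0}) (diagonal_subspace K \<tau>) ({0} \<times> U'))))
     \<and>
     (\<forall>U U' k k'.
        totally_isotropic s b U \<and> vector_space.dim s U = k \<and>
        totally_isotropic s' b' U' \<and> vector_space.dim s' U' = k' \<and>
        int n - int n' = 2 * (int k - int k') \<and>
        compatible_isotropy_types b b' U U'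
      \<longrightarrow>
        (\<forall>K. is_complement s K U (orthogonal_space b U) \<longrightarrow>
          {S. maximal_totally_isotropic (module_prod.scale s s') (sum_form b b') S \<and>
              S \<inter> (UNIV \<times> {0}) = U \<times> {0} \<and> S \<inter> ({0} \<times> UNIV) = {0} \<times> U'}
          \<approx> isometry_group s b K))"
proof -
  interpret W: finite_dimensional_vector_space s Basis by fact
  interpret W': finite_dimensional_vector_space s' Basis' by fact
  interpret char_two_form_pair s b Basis s' b' Basis'
    by unfold_locales fact+
  obtain u where u: "\<And>x. b x x = (b u x)\<^sup>2" "b u u = of_nat n"
    using W.exists_characteristic_vector assms(5) by metis
  obtain u' where u': "\<And>x. b' x x = (b' u' x)\<^sup>2" "b' u' u' = of_nat n'"
    using W'.exists_characteristic_vector assms(7) by metis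
  have of_nat: "(of_nat m :: 'f) = (if even m then 0 else 1)" for m
    by (cases "even m") (auto elim!: evenE oddE simp: W.two_eq_zero)
  have parity: "b u u = b' u' u'"
    using assms(13) by (simp add: u(2) u'(2) of_nat)
  \<comment> \<open>If \<open>b u u\<close> is nonzero, both radicals are zero and the types are
    compatible automatically; otherwise the condition compares membership of \<open>u\<close> and
    \<open>u'\<close>.\<close>
  have compatible: "compatible_isotropy_types b b' U U' \<longleftrightarrow>
      (b u u \<noteq> 0 \<or> u \<in> U \<longleftrightarrow> b u u \<noteq> 0 \<or> u' \<in> U')"
    if "totally_isotropic s b U" "totally_isotropic s' b' U'" for U U'
    using W.radical_alternating_subspace_subset_iff[OF u(1), of U]
      W'.radical_alternating_subspace_subset_iff[OF u'(1), of U'] that parity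
    by (simp add: compatible_isotropy_types_def totally_isotropic_def)
  show ?thesis
  proof (intro conjI allI impI; elim conjE)
    fix S U U' k k'
    assume S: "maximal_totally_isotropic (module_prod.scale s s') (sum_form b b') S"
      and slices: "S \<inter> (UNIV \<times> {0}) = U \<times> {0}" "S \<inter> ({0} \<times> UNIV) = {0} \<times> U'"
      and k: "vector_space.dim s U = k" "vector_space.dim s' U' = k'"
    note perp = self_orthogonal_if_maximal(2)[OF u(1) u'(1) parity S]
    show "int n - int n' = 2 * (int k - int k')"
      using self_orthogonal_dim_eq[OF perp slices] k assms(5,7) by simp
    have uu: "(u, u') \<in> S"
      by (rule self_orthogonal_if_maximal(1)[OF u(1) u'(1) parity S])
    note sub = self_orthogonal_subspace[OF perp slices]
    \<comment> \<open>The two vectors add up to \<open>(u, u')\<close>, which lies in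
      \<open>S\<close>.\<close>
    have "(u, 0) \<in> S \<longleftrightarrow> (0, u') \<in> S"
      using P.p.subspace_diff[OF sub uu, of "(u, 0)"] P.p.subspace_diff[OF sub uu, of "(0, u')"]
      by auto
    then show "compatible_isotropy_types b b' U U'"
      using compatible[OF slice_totally_isotropic[OF perp slices]] slice_mem[OF perp slices] by simp
    fix K K'
    assume "is_complement s K U (orthogonal_space b U)"
      "is_complement s' K' U' (orthogonal_space b' U')"
    then show "\<exists>!\<tau>. \<tau> \<in> isometries s b K s' b' K' \<and>
        orthogonal_direct_sum (sum_form b b') S (U \<times> {0}) (diagonal_subspace K \<tau>) ({0} \<times> U')"
      by (rule self_orthogonal_decomposition[OF perp slices])
  next
    fix U U' k k' K
    assume U: "totally_isotropic s b U" and U': "totally_isotropic s' b' U'"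
      and k: "vector_space.dim s U = k" "vector_space.dim s' U' = k'"
      and dims: "int n - int n' = 2 * (int k - int k')"
      and types: "compatible_isotropy_types b b' U U'"
      and K: "is_complement s K U (orthogonal_space b U)"
    have "U' \<subseteq> orthogonal_space b' U'" "W'.subspace U'"
      using U' by (auto simp: totally_isotropic_def orthogonal_space_def)
    then obtain K' where K': "is_complement s' K' U' (orthogonal_space b' U')"
      using W'.exists_complement[OF _ W'.subspace_orthogonal_space] by metis
    have sub: "W.subspace K" "W'.subspace K'"
      using K K' by (simp_all add: is_complement_def)
    have "W.dim K = W'.dim K'"
      using W.dim_complement[OF U K] W'.dim_complement[OF U' K'] dims k assms(5,7) by simp
    moreover have "b u u = 0" if "u \<in> U"
      using U that by (simp add: totally_isotropic_def)
    moreover have "b u u = 0" if "u' \<in> U'"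
      using U' that parity by (simp add: totally_isotropic_def)
    \<comment> \<open>When \<open>b u u\<close> is nonzero, neither characteristic vector can lie in
      a totally isotropic subspace, so the equivalence holds in that case as well.\<close>
    ultimately have "W.dim K = W'.dim K'" "u \<in> U \<longleftrightarrow> u' \<in> U'"
      using types compatible[OF U U'] by auto
    then obtain \<tau> where \<tau>: "\<tau> \<in> isometries s b K s' b' K'"
      using exists_isometry[OF sub(1) W.radical_complement[OF U K] sub(2) W'.radical_complement[OF U' K']]
        W.complement_alternating_iff[OF u(1) U K] W'.complement_alternating_iff[OF u'(1) U' K'] by metis
    have "isometries s b K s' b' K' \<approx>
      {S. maximal_totally_isotropic P.scale (sum_form b b') S \<and>
        S \<inter> (UNIV \<times> {0}) = U \<times> {0} \<and> S \<inter> ({0} \<times> UNIV) = {0} \<times> U'}"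
      using bij_betw_glue[OF U U' K K' u(1) u'(1) parity] unfolding eqpoll_def by blast
    then show "{S. maximal_totally_isotropic (module_prod.scale s s') (sum_form b b') S \<and>
        S \<inter> (UNIV \<times> {0}) = U \<times> {0} \<and> S \<inter> ({0} \<times> UNIV) = {0} \<times> U'} \<approx> isometry_group s b K"
      using isometries_eqpoll_isometry_group[OF W.vector_space_axioms sub(1) \<tau>]
      by (meson eqpoll_sym eqpoll_trans)
  qed
qed

end
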